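(* Let $r\ge0$, $q=r+1$, and let $\tau\to+\infty$. Let $a_\nu(\tau)$ ($1\le\nu\le q$) and $b_h(\tau)$ ($1\le h\le r$) satisfy, for all large $\tau$, $a_\nu(\tau)>-1$ and $b_h(\tau)>a_h(\tau)$. Put $\varepsilon_\tau=\sqrt{2/\tau}$, $c_\tau=\tau$, $x_\tau(t)=c_\tau(1+\varepsilon_\tau t)$. Assume $$a_q(\tau)+1=\tau+\sqrt{2\tau}\,\widehat a_*+\mathrm O(1)\ (\tau\to+\infty),\qquad\varepsilon_\tau(a_h(\tau)+1)\to\rho_h>0,\qquad b_h(\tau)-a_h(\tau)\to d_h\ge0\quad(1\le h\le r),$$ with $\widehat a_*\in\mathbb R$. Let $w_{0,\tau},w_{1,\tau},\dots,w_{r,\tau}$ be the Laguerre weights of the first kind with these parameters, $Z_\tau=\int_0^\infty w_{0,\tau}(x)\,\mathrm dx$, $Z_{h,\tau}=Z_\tau/(b_h(\tau)+1)$ (see context), and let $F=K_{\rho_1,d_1}\cdots K_{\rho_r,d_r}\phi_{\widehat a_*}$. Then $$\frac{c_\tau\varepsilon_\tau}{Z_{h,\tau}}w_{h,\tau}(x_\tau(t))\xrightarrow[\tau\to+\infty]{}K_{\rho_h,1}F(t)\quad(1\le h\le r),\qquad\frac{c_\tau\varepsilon_\tau}{Z_\tau}w_{0,\tau}(x_\tau(t))\xrightarrow[\tau\to+\infty]{}F(t).$$ Both limits hold weakly as measures (densities with respect to $\mathrm dt$, extended by zero outside $(-\varepsilon_\tau^{-1},\infty)$) and in every fixed polynomial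 moment.
   Context: $\mathcal B_{a,b}(x)=\frac{x^a(1-x)^{b-a-1}}{\Gamma(b-a)}\mathbf 1_{(0,1)}(x)$ ($-1<a<b$); $\mathcal G_a(x)=x^a\mathrm e^{-x}\mathbf 1_{(0,\infty)}(x)$; Mellin convolution $(f*g)(x)=\int_0^\infty f(u)g(x/u)\frac{\mathrm du}u$. $w_{0,\tau}=\mathcal B_{a_1(\tau),b_1(\tau)}*\cdots*\mathcal B_{a_r(\tau),b_r(\tau)}*\mathcal G_{a_q(\tau)}$, and $w_{h,\tau}$ ($1\le h\le r$) is the same convolution with $b_h(\tau)$ replaced by $b_h(\tau)+1$. Explicitly $Z_\tau=\prod_{\nu=1}^{q}\Gamma(a_\nu(\tau)+1)/\prod_{h=1}^r\Gamma(b_h(\tau)+1)$. $\phi_a(t)=\pi^{-1/2}\mathrm e^{-(t-a)^2}$. For $\rho,d>0$: $(K_{\rho,d}f)(t)=\int_0^\infty\frac{\rho^d}{\Gamma(d)}u^{d-1}\mathrm e^{-\rho u}f(t+u)\,\mathrm du$, and $K_{\rho,0}=I$. Weak convergence means convergence of integrals against bounded continuous functions. *)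

theory Defs
  imports "HOL-Probability.Probability" "HOL-Library.Landau_Symbols"
begin

definition beta_weight :: "real \<Rightarrow> real \<Rightarrow> real \<Rightarrow> real" where
  "beta_weight a b x =
     (if 0 < x \<and> x < 1 then x powr a * (1 - x) powr (b - a - 1) / Gamma (b - a) else 0)"

definition gamma_weight :: "real \<Rightarrow> real \<Rightarrow> real" where
  "gamma_weight a x = (if 0 < x then x powr a * exp (- x) else 0)"

definition mellin_conv :: "(real \<Rightarrow> real) \<Rightarrow> (real \<Rightarrow> real) \<Rightarrow> real \<Rightarrow> real" where
  "mellin_conv f g x = (LBINT u:{0<..}. f u * g (x / u) / u)"

text \<open>The iterated Mellin convolution is bracketed to the right; the indices of the parameter
  families start at 1, and the gamma factor carries the index \<open>q = r + 1\<close>.\<close>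

definition laguerre_weight0 ::
    "nat \<Rightarrow> (nat \<Rightarrow> real) \<Rightarrow> (nat \<Rightarrow> real) \<Rightarrow> real \<Rightarrow> real" where
  "laguerre_weight0 r a b =
     foldr (\<lambda>h. mellin_conv (beta_weight (a h) (b h))) [1..<r+1] (gamma_weight (a (r + 1)))"

definition laguerre_weight ::
    "nat \<Rightarrow> nat \<Rightarrow> (nat \<Rightarrow> real) \<Rightarrow> (nat \<Rightarrow> real) \<Rightarrow> real \<Rightarrow> real" where
  "laguerre_weight h r a b = laguerre_weight0 r a (b(h := b h + 1))"

definition laguerre_mass :: "nat \<Rightarrow> (nat \<Rightarrow> real) \<Rightarrow> (nat \<Rightarrow> real) \<Rightarrow> real" where
  "laguerre_mass r a b = (LBINT x:{0<..}. laguerre_weight0 r a b x)"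

definition gauss_phi :: "real \<Rightarrow> real \<Rightarrow> real" where
  "gauss_phi a t = exp (- ((t - a)\<^sup>2)) / sqrt pi"

definition K_op :: "real \<Rightarrow> real \<Rightarrow> (real \<Rightarrow> real) \<Rightarrow> real \<Rightarrow> real" where
  "K_op \<rho> d f t =
     (if d = 0 then f t
      else (LBINT u:{0<..}. \<rho> powr d / Gamma d * u powr (d - 1) * exp (- \<rho> * u) * f (t + u)))"

definition limit_profile ::
    "nat \<Rightarrow> (nat \<Rightarrow> real) \<Rightarrow> (nat \<Rightarrow> real) \<Rightarrow> real \<Rightarrow> real \<Rightarrow> real" where
  "limit_profile r \<rho> d ahat = foldr (\<lambda>h. K_op (\<rho> h) (d h)) [1..<r+1] (gauss_phi ahat)"

definition scale_eps :: "real \<Rightarrow> real" where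
  "scale_eps \<tau> = sqrt (2 / \<tau>)"

definition scale_c :: "real \<Rightarrow> real" where
  "scale_c \<tau> = \<tau>"

definition scaled_point :: "real \<Rightarrow> real \<Rightarrow> real" where
  "scaled_point \<tau> t = scale_c \<tau> * (1 + scale_eps \<tau> * t)"

definition rescaled_density :: "real \<Rightarrow> real \<Rightarrow> (real \<Rightarrow> real) \<Rightarrow> real \<Rightarrow> real" where
  "rescaled_density \<tau> Z w t =
     (if - 1 / scale_eps \<tau> < t then scale_c \<tau> * scale_eps \<tau> / Z * w (scaled_point \<tau> t) else 0)"

definition density_measure :: "(real \<Rightarrow> real) \<Rightarrow> real measure" where
  "density_measure f = density lborel (\<lambda>t. ennreal (f t))"

text \<open>The library's \<open>weak_conv_m\<close> only covers sequences indexed by the natural numbers and is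
  phrased through distribution functions; here the index runs along an arbitrary filter.\<close>

definition weakly_converges ::
    "('i \<Rightarrow> real measure) \<Rightarrow> real measure \<Rightarrow> 'i filter \<Rightarrow> bool" where
  "weakly_converges M N \<F> \<longleftrightarrow>
     (\<forall>g::real \<Rightarrow> real. continuous_on UNIV g \<longrightarrow> bounded (range g) \<longrightarrow>
        ((\<lambda>i. integral\<^sup>L (M i) g) \<longlongrightarrow> integral\<^sup>L N g) \<F>)"

text \<open>Existence of the moments is part of the notion: the Bochner integral of a non-integrable
  function is 0 by convention.\<close>

definition moments_converge ::
    "('i \<Rightarrow> real measure) \<Rightarrow> real measure \<Rightarrow> 'i filter \<Rightarrow> bool" where
  "moments_converge M N \<F> \<longleftrightarrow>
     (\<forall>p::real poly.
        (\<forall>\<^sub>F i in \<F>. integrable (M i) (poly p)) \<and> integrable N (poly p) \<and>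
        ((\<lambda>i. integral\<^sup>L (M i) (poly p)) \<longlongrightarrow> integral\<^sup>L N (poly p)) \<F>)"

end

theory Submission
  imports Defs "HOL-Real_Asymp.Real_Asymp"
begin

text \<open>Normalised, the weight \<open>w\<^sub>0\<close> is the density of a product of independent Beta variables and one
  Gamma variable, and \<open>F\<close> is the density of a Gaussian minus independent Gamma variables of
  shape \<open>d\<^sub>h\<close> and rate \<open>\<rho>\<^sub>h\<close>. In the coordinate \<open>x = c (1 + \<epsilon> t)\<close> a product becomes
  \<open>s + t + \<epsilon> s t\<close>, so as \<open>\<epsilon>\<close> tends to 0 the moments of a product converge to those of a sum as
  soon as the moments of the factors converge. These follow from the explicit Beta moments and from a
  recurrence (Stein's identity) for the central Gamma moments. The limit has an exponential moment,
  hence convergence of moments implies convergence of characteristic functions, and Levy's theorem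
  gives weak convergence. Increasing \<open>b\<^sub>h\<close> by 1 increases \<open>d\<^sub>h\<close> by 1, and on the level of exponential
  generating functions of moments this is multiplication by the factor of \<open>K\<close> with parameters
  \<open>\<rho>\<^sub>h\<close> and 1.\<close>

section \<open>Weak convergence from convergence of moments\<close>

text \<open>The scales explain the hypotheses. Since \<open>a h + 1\<close> is of order
  \<open>1 / \<epsilon>\<close>, a Beta factor stays within order \<open>\<epsilon>\<close> of 1.
  The Gamma factor has mean about \<open>\<tau>\<close> and standard deviation about
  \<open>sqrt \<tau>\<close>, which is \<open>1 / sqrt 2\<close> in units of
  \<open>\<tau> \<epsilon> = sqrt (2 \<tau>)\<close>; hence the variance 1/2 of the Gaussian. All
  factors thus fluctuate on the same scale. Comparing densities directly would meet degenerate
  cases: for \<open>d h = 0\<close> the rescaled Beta factor shrinks to a point mass, and for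
  \<open>d h\<close> between 0 and 1 its limit density is unbounded. Moments do not see the
  difference, because rising factorials of \<open>b h - a h\<close> are continuous down to 0. The
  passage from moments to characteristic functions goes through Taylor's formula with explicit
  remainders. An exponential moment is required of the limit only; of the approximating laws just
  the ordinary moments are used.\<close>

lemma power_div_fact_le_exp: "0 \<le> x \<Longrightarrow> x ^ k / fact k \<le> exp (x::real)"
  using sum_le_suminf[OF summable_exp_generic[of x], of "{k}"] by (simp add: exp_def field_simps)

text \<open>The surplus rate \<open>c - s\<close> pays for the power: one term of the exponential
  series bounds \<open>\<bar>x\<bar> ^ k\<close> by a multiple of
  \<open>exp ((c - s) * \<bar>x\<bar>)\<close>. The case \<open>s = 0\<close> gives moments, the
  case of positive \<open>s\<close> a dominating function for Taylor remainders.\<close>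

lemma integrable_abs_power_exp:
  assumes M: "sets M = sets borel" and c: "integrable M (\<lambda>x. exp (c * \<bar>x\<bar>))" and s: "s < (c::real)"
  shows "integrable M (\<lambda>x::real. \<bar>x\<bar> ^ k * exp (s * \<bar>x\<bar>))"
proof (rule Bochner_Integration.integrable_bound)
  note [measurable_cong] = M
  show "integrable M (\<lambda>x. fact k / (c - s) ^ k * exp (c * \<bar>x\<bar>))"
    using c by simp
  show "(\<lambda>x. \<bar>x\<bar> ^ k * exp (s * \<bar>x\<bar>)) \<in> borel_measurable M" by measurable
  have "\<bar>x\<bar> ^ k * exp (s * \<bar>x\<bar>) \<le> fact k / (c - s) ^ k * exp (c * \<bar>x\<bar>)" for x
  proof -
    define w where "w = c - s"
    have "w > 0" using s by (simp add: w_def)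
    then have "(w * \<bar>x\<bar>) ^ k / fact k \<le> exp (w * \<bar>x\<bar>)"
      by (intro power_div_fact_le_exp) simp
    with \<open>w > 0\<close> have "\<bar>x\<bar> ^ k \<le> fact k / (c - s) ^ k * exp ((c - s) * \<bar>x\<bar>)"
      unfolding w_def[symmetric] by (simp add: field_simps power_mult_distrib)
    then have "\<bar>x\<bar> ^ k * exp (s * \<bar>x\<bar>) \<le> fact k / (c - s) ^ k * exp ((c - s) * \<bar>x\<bar>) * exp (s * \<bar>x\<bar>)"
      by (intro mult_right_mono) auto
    also have "\<dots> = fact k / (c - s) ^ k * exp (c * \<bar>x\<bar>)"
      by (simp add: exp_add[symmetric] algebra_simps)
    finally show ?thesis .
  qed
  then show "AE x in M. norm (\<bar>x\<bar> ^ k * exp (s * \<bar>x\<bar>)) \<le> norm (fact k / (c - s) ^ k * exp (c * \<bar>x\<bar>))"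
    using s by (intro AE_I2) simp
qed

lemma integrable_power_exp_moment:
  assumes "sets M = sets borel" "integrable M (\<lambda>x. exp (c * \<bar>x\<bar>))" "0 < (c::real)"
  shows "integrable M (\<lambda>x::real. x ^ k)"
proof -
  note [measurable_cong] = assms(1)
  have "integrable M (\<lambda>x. \<bar>x\<bar> ^ k)"
    using integrable_abs_power_exp[OF assms, of k] by simp
  then show ?thesis
    by (rule Bochner_Integration.integrable_bound) (auto simp: power_abs)
qed

lemma integrable_abs_power:
  assumes "sets M = sets borel" "\<And>k. integrable M (\<lambda>x::real. x ^ k)"
  shows "integrable M (\<lambda>x. \<bar>x\<bar> ^ k)"
  using integrable_norm[OF assms(2)[of k]] by (simp add: power_abs)

text \<open>Pointwise Taylor expansion of \<open>iexp (s * x)\<close>, multiplied by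
  \<open>x ^ k * iexp (t * x)\<close> and integrated. The factor \<open>x ^ k\<close> is needed
  because the Taylor coefficients at \<open>t\<close> are themselves integrals of this kind, with
  higher powers.\<close>

lemma iexp_power_taylor_bound:
  assumes M: "sets M = sets borel" and int: "\<And>k. integrable M (\<lambda>x::real. x ^ k)"
  shows "cmod ((CLINT x|M. complex_of_real (x ^ k) * iexp ((t + s) * x))
      - (\<Sum>j\<le>n. (\<i> * s) ^ j / fact j * (CLINT x|M. complex_of_real (x ^ (k + j)) * iexp (t * x))))
    \<le> \<bar>s\<bar> ^ Suc n / fact (Suc n) * (LINT x|M. \<bar>x\<bar> ^ (k + Suc n))"
proof -
  note [measurable_cong] = M
  have I: "integrable M (\<lambda>x. complex_of_real (x ^ i) * iexp (u * x))" for i u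
    by (rule Bochner_Integration.integrable_bound[OF int[of i]]) (auto simp: norm_mult norm_power power_abs)
  have "(CLINT x|M. complex_of_real (x ^ k) * iexp ((t + s) * x))
      - (\<Sum>j\<le>n. (\<i> * s) ^ j / fact j * (CLINT x|M. complex_of_real (x ^ (k + j)) * iexp (t * x)))
    = (CLINT x|M. complex_of_real (x ^ k) * iexp ((t + s) * x)
      - (\<Sum>j\<le>n. (\<i> * s) ^ j / fact j * (complex_of_real (x ^ (k + j)) * iexp (t * x))))"
    by (subst Bochner_Integration.integral_diff, rule I, intro Bochner_Integration.integrable_sum integrable_mult_right I,
        subst Bochner_Integration.integral_sum, intro integrable_mult_right I)
      (simp only: integral_mult_right_zero)
  also have "cmod \<dots> \<le> (LINT x|M. \<bar>s\<bar> ^ Suc n / fact (Suc n) * \<bar>x\<bar> ^ (k + Suc n))"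
  proof (rule Bochner_Integration.integral_norm_bound_integral)
    show "integrable M (\<lambda>x. complex_of_real (x ^ k) * iexp ((t + s) * x)
      - (\<Sum>j\<le>n. (\<i> * s) ^ j / fact j * (complex_of_real (x ^ (k + j)) * iexp (t * x))))"
      by (intro Bochner_Integration.integrable_diff Bochner_Integration.integrable_sum integrable_mult_right I)
    show "integrable M (\<lambda>x. \<bar>s\<bar> ^ Suc n / fact (Suc n) * \<bar>x\<bar> ^ (k + Suc n))"
      using integrable_abs_power[OF M int] by (intro integrable_mult_right)
    fix x
    have "complex_of_real (x ^ k) * iexp ((t + s) * x) - (\<Sum>j\<le>n. (\<i> * s) ^ j / fact j * (complex_of_real (x ^ (k + j)) * iexp (t * x)))
      = complex_of_real (x ^ k) * iexp (t * x) * (iexp (s * x) - (\<Sum>j\<le>n. (\<i> * (s * x)) ^ j / fact j))"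
      by (simp add: algebra_simps sum_distrib_left exp_add power_add power_mult_distrib)
    also have "cmod \<dots> = \<bar>x\<bar> ^ k * cmod (iexp (s * x) - (\<Sum>j\<le>n. (\<i> * (s * x)) ^ j / fact j))"
      by (simp add: norm_mult norm_power)
    also have "\<dots> \<le> \<bar>x\<bar> ^ k * (\<bar>s * x\<bar> ^ Suc n / fact (Suc n))"
      using iexp_approx1[of "s * x" n] by (intro mult_left_mono) auto
    also have "\<dots> = \<bar>s\<bar> ^ Suc n / fact (Suc n) * \<bar>x\<bar> ^ (k + Suc n)"
      by (simp add: abs_mult power_mult_distrib power_add)
    finally show "cmod (complex_of_real (x ^ k) * iexp ((t + s) * x)
      - (\<Sum>j\<le>n. (\<i> * s) ^ j / fact j * (complex_of_real (x ^ (k + j)) * iexp (t * x))))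
      \<le> \<bar>s\<bar> ^ Suc n / fact (Suc n) * \<bar>x\<bar> ^ (k + Suc n)" .
  qed
  also have "\<dots> = \<bar>s\<bar> ^ Suc n / fact (Suc n) * (LINT x|M. \<bar>x\<bar> ^ (k + Suc n))"
    by simp
  finally show ?thesis .
qed

text \<open>Under the integral the remainder is a single term of the series of
  \<open>exp (\<bar>s\<bar> * \<bar>x\<bar>)\<close>, times \<open>\<bar>x\<bar> ^ k\<close>. It
  tends to 0 pointwise and the whole exponential dominates it.\<close>

lemma moment_taylor_remainder_tendsto_0:
  assumes M: "sets M = sets borel" and c: "integrable M (\<lambda>x::real. exp (c * \<bar>x\<bar>))" "\<bar>s\<bar> < c"
  shows "(\<lambda>n. \<bar>s\<bar> ^ n / fact n * (LINT x|M. \<bar>x\<bar> ^ (k + n))) \<longlonglongrightarrow> 0"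
proof -
  note [measurable_cong] = M
  have "(\<lambda>n. LINT x|M. \<bar>x\<bar> ^ k * ((\<bar>s\<bar> * \<bar>x\<bar>) ^ n / fact n)) \<longlonglongrightarrow> (LINT x|M. 0)"
  proof (rule integral_dominated_convergence[where w = "\<lambda>x. \<bar>x\<bar> ^ k * exp (\<bar>s\<bar> * \<bar>x\<bar>)"])
    show "integrable M (\<lambda>x. \<bar>x\<bar> ^ k * exp (\<bar>s\<bar> * \<bar>x\<bar>))"
      by (rule integrable_abs_power_exp[OF M c])
    show "AE x in M. (\<lambda>n. \<bar>x\<bar> ^ k * ((\<bar>s\<bar> * \<bar>x\<bar>) ^ n / fact n)) \<longlonglongrightarrow> 0"
    proof (intro AE_I2 tendsto_mult_right_zero)
      fix x :: real
      show "(\<lambda>n. (\<bar>s\<bar> * \<bar>x\<bar>) ^ n / fact n) \<longlonglongrightarrow> 0"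
        using summable_LIMSEQ_zero[OF summable_exp[of "\<bar>s\<bar> * \<bar>x\<bar>"]] by (simp add: field_simps)
    qed
    show "AE x in M. norm (\<bar>x\<bar> ^ k * ((\<bar>s\<bar> * \<bar>x\<bar>) ^ n / fact n)) \<le> \<bar>x\<bar> ^ k * exp (\<bar>s\<bar> * \<bar>x\<bar>)" for n
      unfolding real_norm_def
      by (intro AE_I2, subst abs_of_nonneg) (auto simp del: times_divide_eq_right intro!: mult_left_mono power_div_fact_le_exp)
  qed auto
  also have "(\<lambda>n. LINT x|M. \<bar>x\<bar> ^ k * ((\<bar>s\<bar> * \<bar>x\<bar>) ^ n / fact n))
    = (\<lambda>n. LINT x|M. \<bar>s\<bar> ^ n / fact n * \<bar>x\<bar> ^ (k + n))"
    by (simp add: power_mult_distrib power_add mult_ac)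
  finally show ?thesis by simp
qed

text \<open>Taylor expansion about \<open>t\<close> only reaches \<open>\<bar>s\<bar> < c\<close>; iterating this step covers all arguments of the
  characteristic function. The order of the expansion is chosen such that an even moment bounds the
  remainder; there the absolute value can be dropped.\<close>

lemma char_moments_tendsto_step:
  fixes M :: "nat \<Rightarrow> real measure"
  assumes M: "\<And>n. sets (M n) = sets borel" "\<And>n k. integrable (M n) (\<lambda>x. x ^ k)"
    and N: "sets N = sets borel" "integrable N (\<lambda>x. exp (c * \<bar>x\<bar>))" "\<bar>s\<bar> < c"
    and mom: "\<And>k. (\<lambda>n. LINT x|M n. x ^ k) \<longlonglongrightarrow> (LINT x|N. x ^ k)"
    and t: "\<And>k. (\<lambda>n. CLINT x|M n. complex_of_real (x ^ k) * iexp (t * x)) \<longlonglongrightarrow> (CLINT x|N. complex_of_real (x ^ k) * iexp (t * x))"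
  shows "(\<lambda>n. CLINT x|M n. complex_of_real (x ^ k) * iexp ((t + s) * x)) \<longlonglongrightarrow> (CLINT x|N. complex_of_real (x ^ k) * iexp ((t + s) * x))"
proof (rule LIMSEQ_I)
  fix e :: real assume e: "e > 0"
  have c: "0 < c" using N(3) by linarith
  have Nint: "integrable N (\<lambda>x. x ^ k)" for k
    using integrable_power_exp_moment[OF N(1,2) c] .
  have "(\<lambda>n. \<bar>s\<bar> ^ n / fact n * (LINT x|N. \<bar>x\<bar> ^ (k + n))) \<longlonglongrightarrow> 0"
    by (rule moment_taylor_remainder_tendsto_0[OF N])
  then have "\<forall>\<^sub>F n in sequentially. \<bar>s\<bar> ^ n / fact n * (LINT x|N. \<bar>x\<bar> ^ (k + n)) < e / 4"
    using e by (auto dest: order_tendstoD(2)[where a = "e / 4"])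
  then obtain m0 where m0: "\<And>n. n \<ge> m0 \<Longrightarrow> \<bar>s\<bar> ^ n / fact n * (LINT x|N. \<bar>x\<bar> ^ (k + n)) < e / 4"
    by (auto simp: eventually_sequentially)
  \<comment> \<open>With this choice \<open>k + Suc m = 2 * (k + m0 + 1)\<close> is even and
    \<open>Suc m\<close> is at least \<open>m0\<close>.\<close>
  define m where "m = k + 2 * m0 + 1"
  define B where "B A = \<bar>s\<bar> ^ Suc m / fact (Suc m) * (LINT x|A. \<bar>x\<bar> ^ (k + Suc m))" for A :: "real measure"
  have ev: "even (k + Suc m)" by (simp add: m_def)
  have Beq: "B A = \<bar>s\<bar> ^ Suc m / fact (Suc m) * (LINT x|A. x ^ (k + Suc m))" for A
    unfolding B_def by (subst power_even_abs[OF ev]) simp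
  have BN: "B N < e / 4"
    unfolding B_def by (rule m0) (simp add: m_def)
  \<comment> \<open>No exponential moment of \<open>M n\<close> is available. Its remainder is small
    because it is an even moment up to a constant, and so converges to the remainder of
    \<open>N\<close>.\<close>
  have "(\<lambda>n. B (M n)) \<longlonglongrightarrow> B N"
    unfolding Beq by (intro tendsto_intros mom)
  then have 1: "\<forall>\<^sub>F n in sequentially. B (M n) < e / 4"
    using BN by (rule order_tendstoD(2))
  define S where "S A = (\<Sum>j\<le>m. (\<i> * s) ^ j / fact j * (CLINT x|A. complex_of_real (x ^ (k + j)) * iexp (t * x)))" for A :: "real measure"
  have "(\<lambda>n. S (M n)) \<longlonglongrightarrow> S N"
    unfolding S_def by (intro tendsto_sum tendsto_mult[OF tendsto_const] t)
  then have 2: "\<forall>\<^sub>F n in sequentially. cmod (S (M n) - S N) < e / 4"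
    using e unfolding tendsto_iff dist_norm by (auto elim: allE[of _ "e / 4"])
  define C where "C A = (CLINT x|A. complex_of_real (x ^ k) * iexp ((t + s) * x))" for A :: "real measure"
  have T: "cmod (C A - S A) \<le> B A" if "sets A = sets borel" "\<And>k. integrable A (\<lambda>x. x ^ k)" for A
    unfolding C_def S_def B_def by (rule iexp_power_taylor_bound[OF that])
  have "\<forall>\<^sub>F n in sequentially. cmod (C (M n) - C N) < e"
    using 1 2
  proof eventually_elim
    case (elim n)
    have "C (M n) - C N = (C (M n) - S (M n)) + (S (M n) - S N) - (C N - S N)"
      by simp
    also have "cmod \<dots> \<le> cmod (C (M n) - S (M n)) + cmod (S (M n) - S N) + cmod (C N - S N)"
      by (meson norm_triangle_ineq norm_triangle_ineq4 order_trans add_right_mono)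
    also have "\<dots> < e"
      using elim BN e T[OF M, of n] T[OF N(1) Nint] by linarith
    finally show ?case .
  qed
  then show "\<exists>no. \<forall>n\<ge>no. cmod ((CLINT x|M n. complex_of_real (x ^ k) * iexp ((t + s) * x)) - (CLINT x|N. complex_of_real (x ^ k) * iexp ((t + s) * x))) < e"
    by (simp add: C_def eventually_sequentially)
qed

lemma char_tendsto_of_moments:
  fixes M :: "nat \<Rightarrow> real measure"
  assumes M: "\<And>n. sets (M n) = sets borel" "\<And>n k. integrable (M n) (\<lambda>x. x ^ k)"
    and N: "sets N = sets borel" "integrable N (\<lambda>x. exp (c * \<bar>x\<bar>))" "0 < c"
    and mom: "\<And>k. (\<lambda>n. LINT x|M n. x ^ k) \<longlonglongrightarrow> (LINT x|N. x ^ k)"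
  shows "(\<lambda>n. char (M n) t) \<longlonglongrightarrow> char N t"
proof -
  obtain m :: nat where m: "\<bar>t\<bar> / c < m"
    using reals_Archimedean2 by blast
  then have "m > 0" using N(3) by (intro Nat.gr0I) (auto simp: field_simps)
  define s where "s = t / m"
  have s: "\<bar>s\<bar> < c"
    using m N(3) \<open>m > 0\<close> by (simp add: s_def field_simps)
  \<comment> \<open>All \<open>k\<close> are carried through the induction together: one step at
    order \<open>k\<close> consumes the orders \<open>k\<close> to \<open>k + m\<close> at the
    previous point, with no bound on \<open>m\<close> fixed in advance.\<close>
  have "\<forall>k. (\<lambda>n. CLINT x|M n. complex_of_real (x ^ k) * iexp (real j * s * x)) \<longlonglongrightarrow> (CLINT x|N. complex_of_real (x ^ k) * iexp (real j * s * x))" for j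
  proof (induction j)
    case 0
    have "(\<lambda>n. complex_of_real (LINT x|M n. x ^ k)) \<longlonglongrightarrow> complex_of_real (LINT x|N. x ^ k)" for k
      by (intro tendsto_of_real mom)
    then show ?case by (simp flip: of_real_power)
  next
    case (Suc j)
    have "(\<lambda>n. CLINT x|M n. complex_of_real (x ^ k) * iexp ((real j * s + s) * x))
        \<longlonglongrightarrow> (CLINT x|N. complex_of_real (x ^ k) * iexp ((real j * s + s) * x))" for k
      using Suc by (intro char_moments_tendsto_step[OF M N(1,2) s mom]) blast
    then show ?case by (simp add: algebra_simps)
  qed
  from spec[OF this[of m], of 0] show ?thesis
    using \<open>m > 0\<close> by (simp add: char_def s_def)
qed

text \<open>The continuity theorem concerns sequences, hence the restriction of the filter to a
  sequence \<open>X\<close> running along it.\<close>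

lemma weak_conv_of_moments:
  fixes M :: "'i \<Rightarrow> real measure" and g :: "real \<Rightarrow> real"
  assumes M: "\<forall>\<^sub>F i in \<F>. real_distribution (M i) \<and> (\<forall>k. integrable (M i) (\<lambda>x. x ^ k))"
    and N: "real_distribution N" "integrable N (\<lambda>x. exp (c * \<bar>x\<bar>))" "0 < c"
    and mom: "\<And>k. ((\<lambda>i. LINT x|M i. x ^ k) \<longlongrightarrow> (LINT x|N. x ^ k)) \<F>"
    and X: "filterlim X \<F> sequentially"
    and g: "continuous_on UNIV g" "bounded (range g)"
  shows "(\<lambda>n. integral\<^sup>L (M (X n)) g) \<longlonglongrightarrow> integral\<^sup>L N g"
proof -
  interpret N: real_distribution N by fact
  define Q where "Q i \<longleftrightarrow> real_distribution (M i) \<and> (\<forall>k. integrable (M i) (\<lambda>x. x ^ k))" for i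
  \<comment> \<open>The hypotheses hold only eventually, while the continuity theorem wants a
    distribution at every index; the finitely many exceptions are filled with \<open>N\<close>
    itself.\<close>
  define M' where "M' n = (if Q (X n) then M (X n) else N)" for n
  have ev: "\<forall>\<^sub>F n in sequentially. M' n = M (X n)"
    using filterlim_iff[THEN iffD1, OF X, rule_format, OF M]
    by eventually_elim (simp add: M'_def Q_def)
  have rd: "real_distribution (M' n)" and int: "integrable (M' n) (\<lambda>x. x ^ k)" for n k
    using integrable_power_exp_moment[OF N.events_eq_borel N(2,3)] N(1)
    by (auto simp: M'_def Q_def)
  have conv: "(\<lambda>n. f (M' n)) \<longlonglongrightarrow> l \<longleftrightarrow> (\<lambda>n. f (M (X n))) \<longlonglongrightarrow> l" for f :: "real measure \<Rightarrow> real" and l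
    by (rule tendsto_cong) (use ev in eventually_elim, simp)
  have "(\<lambda>n. LINT x|M' n. x ^ k) \<longlonglongrightarrow> (LINT x|N. x ^ k)" for k
    by (rule conv[of "\<lambda>A. LINT x|A. x ^ k", THEN iffD2]) (rule filterlim_compose[OF mom X])
  then have "weak_conv_m M' N"
    using rd int N by (intro levy_continuity char_tendsto_of_moments[where c = c])
      (auto simp: real_distribution_def real_distribution_axioms_def)
  moreover obtain B where "\<And>x. norm (g x) \<le> B"
    using g(2) by (auto simp: bounded_iff)
  moreover have "\<And>x. isCont g x"
    using g(1) by (simp add: continuous_on_eq_continuous_at)
  ultimately have "(\<lambda>n. integral\<^sup>L (M' n) g) \<longlonglongrightarrow> integral\<^sup>L N g"
    using rd N(1) by (intro weak_conv_imp_integral_bdd_continuous_conv)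
  then show ?thesis by (rule conv[THEN iffD1])
qed

text \<open>Convergence along \<open>at_top\<close> on the reals can be tested on sequences tending
  to infinity, which reduces the weak part to the sequential statement. Polynomial moments follow
  from monomials by linearity.\<close>

lemma weakly_and_moments_converge:
  fixes M :: "real \<Rightarrow> real measure"
  assumes M: "\<forall>\<^sub>F i in at_top. real_distribution (M i) \<and> (\<forall>k. integrable (M i) (\<lambda>x. x ^ k))"
    and N: "real_distribution N" "integrable N (\<lambda>x. exp (c * \<bar>x\<bar>))" "0 < c"
    and mom: "\<And>k. ((\<lambda>i. LINT x|M i. x ^ k) \<longlongrightarrow> (LINT x|N. x ^ k)) at_top"
  shows "weakly_converges M N at_top \<and> moments_converge M N at_top"
proof
  show "weakly_converges M N at_top"
    unfolding weakly_converges_def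
    by (intro allI impI tendsto_at_topI_sequentially weak_conv_of_moments[OF assms])
  have poly: "poly p = (\<lambda>x. \<Sum>i\<le>degree p. coeff p i * x ^ i)" for p :: "real poly"
    by (rule ext) (rule poly_altdef)
  interpret N: real_distribution N by fact
  have Nint: "integrable N (\<lambda>x. x ^ k)" for k
    using integrable_power_exp_moment[OF N.events_eq_borel N(2,3)] .
  have integral_poly: "integral\<^sup>L A (poly p) = (\<Sum>i\<le>degree p. coeff p i * (LINT x|A. x ^ i))"
    if "\<And>k. integrable A (\<lambda>x. x ^ k)" for A and p :: "real poly"
    using that by (simp add: poly)
  show "moments_converge M N at_top"
    unfolding moments_converge_def
  proof (intro allI conjI)
    fix p :: "real poly"
    show "\<forall>\<^sub>F i in at_top. integrable (M i) (poly p)"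
      using M by eventually_elim (auto simp: poly)
    show "integrable N (poly p)" using Nint by (auto simp: poly)
    have "((\<lambda>i. \<Sum>j\<le>degree p. coeff p j * (LINT x|M i. x ^ j))
        \<longlongrightarrow> (\<Sum>j\<le>degree p. coeff p j * (LINT x|N. x ^ j))) at_top"
      by (intro tendsto_intros mom)
    moreover have "\<forall>\<^sub>F i in at_top. (\<Sum>j\<le>degree p. coeff p j * (LINT x|M i. x ^ j)) = integral\<^sup>L (M i) (poly p)"
      using M by eventually_elim (simp add: integral_poly)
    ultimately show "((\<lambda>i. integral\<^sup>L (M i) (poly p)) \<longlongrightarrow> integral\<^sup>L N (poly p)) at_top"
      unfolding integral_poly[OF Nint] by (rule Lim_transform_eventually)
  qed
qed

section \<open>Mellin convolution and the operator K as image measures\<close>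

lemma sets_density_measure [simp, measurable_cong]: "sets (density_measure f) = sets borel"
  by (simp add: density_measure_def)

lemma space_density_measure [simp]: "space (density_measure f) = UNIV"
  by (simp add: density_measure_def)

lemma nn_integral_density_measure:
  assumes "f \<in> borel_measurable borel" "g \<in> borel_measurable borel"
  shows "(\<integral>\<^sup>+x. g x \<partial>density_measure f) = (\<integral>\<^sup>+x. ennreal (f x) * g x \<partial>lborel)"
  using assms by (simp add: density_measure_def nn_integral_density)

text \<open>Tonelli's theorem and, for each fixed \<open>u\<close>, the substitution
  \<open>y = m u * x + n u\<close> with Jacobian \<open>m u\<close>. The form covers both operations
  at once: \<open>m u = 1 / u\<close>, \<open>n u = 0\<close> is the Mellin convolution, and
  \<open>m u = 1\<close>, \<open>n u = u\<close> is the operator K.\<close>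

lemma density_measure_affine_kernel:
  fixes p q m n :: "real \<Rightarrow> real"
  assumes meas [measurable]: "p \<in> borel_measurable borel" "q \<in> borel_measurable borel"
      "m \<in> borel_measurable borel" "n \<in> borel_measurable borel"
    and p: "\<And>u. p u \<ge> 0" "\<And>u. u \<le> 0 \<Longrightarrow> p u = 0" and q: "\<And>y. q y \<ge> 0"
    and m: "\<And>u. u > 0 \<Longrightarrow> m u > 0"
    and fin: "finite_measure (density_measure p)" "finite_measure (density_measure q)"
    and h: "\<And>x. h x = (LBINT u:{0<..}. p u * (m u * q (m u * x + n u)))"
  shows "h \<in> borel_measurable borel" "\<And>x. h x \<ge> 0"
    "density_measure h =
       distr (density_measure p \<Otimes>\<^sub>M density_measure q) borel (\<lambda>(u, y). (y - n u) / m u)"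
proof -
  interpret P: finite_measure "density_measure p" by fact
  interpret Q: finite_measure "density_measure q" by fact
  have h': "h = (\<lambda>x. (\<integral>u. indicator {0<..} u * (p u * (m u * q (m u * x + n u))) \<partial>lborel))"
    by (rule ext) (simp add: h set_lebesgue_integral_def)
  show [measurable]: "h \<in> borel_measurable borel"
    unfolding h' by measurable
  have nonneg: "0 \<le> indicator {0<..} u * (p u * (m u * q (m u * x + n u)))" for u x
    using p(1)[of u] q[of "m u * x + n u"] m[of u]
    by (cases "u > 0") (auto intro!: mult_nonneg_nonneg)
  then show h_nonneg: "h x \<ge> 0" for x
    unfolding h' by (intro integral_nonneg_AE) simp
  \<comment> \<open>\<open>h\<close> is a Bochner integral, which is 0 by convention where it
    diverges. \<open>H\<close> is the same integral in \<open>ennreal\<close>, so Tonelli applies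
    without integrability; its total integral is finite, so the two agree almost everywhere.\<close>
  define H where "H x = (\<integral>\<^sup>+u. ennreal (indicator {0<..} u * (p u * (m u * q (m u * x + n u)))) \<partial>lborel)" for x
  have H_meas [measurable]: "H \<in> borel_measurable borel"
    unfolding H_def by measurable
  have *: "(\<integral>\<^sup>+x. H x * indicator A x \<partial>lborel) =
      (\<integral>\<^sup>+u. \<integral>\<^sup>+y. indicator A ((y - n u) / m u) \<partial>density_measure q \<partial>density_measure p)"
    (is "?L = ?R") if [measurable]: "A \<in> sets borel" for A
  proof -
    have "?L = (\<integral>\<^sup>+x. \<integral>\<^sup>+u. ennreal (indicator {0<..} u * (p u * (m u * q (m u * x + n u)))) * indicator A x \<partial>lborel \<partial>lborel)"
      unfolding H_def by (intro nn_integral_cong) (simp add: nn_integral_multc)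
    also have "\<dots> = (\<integral>\<^sup>+u. \<integral>\<^sup>+x. ennreal (indicator {0<..} u * (p u * (m u * q (m u * x + n u)))) * indicator A x \<partial>lborel \<partial>lborel)"
      by (rule lborel_pair.Fubini') measurable
    also have "\<dots> = (\<integral>\<^sup>+u. ennreal (p u) * (\<integral>\<^sup>+y. ennreal (q y) * indicator A ((y - n u) / m u) \<partial>lborel) \<partial>lborel)"
    proof (intro nn_integral_cong)
      fix u :: real
      show "(\<integral>\<^sup>+x. ennreal (indicator {0<..} u * (p u * (m u * q (m u * x + n u)))) * indicator A x \<partial>lborel)
        = ennreal (p u) * (\<integral>\<^sup>+y. ennreal (q y) * indicator A ((y - n u) / m u) \<partial>lborel)"
      proof (cases "u > 0")
        case False
        then show ?thesis using p(2)[of u] by simp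
      next
        case True
        have mu: "m u > 0" using m True by simp
        have "(\<integral>\<^sup>+y. ennreal (q y) * indicator A ((y - n u) / m u) \<partial>lborel)
          = \<bar>m u\<bar> * (\<integral>\<^sup>+x. ennreal (q (n u + m u * x)) * indicator A ((n u + m u * x - n u) / m u) \<partial>lborel)"
          using mu by (subst nn_integral_real_affine[where c = "m u" and t = "n u"]) auto
        also have "\<dots> = (\<integral>\<^sup>+x. ennreal (m u * q (m u * x + n u)) * indicator A x \<partial>lborel)"
          using mu q by (subst nn_integral_cmult[symmetric], measurable)
            (simp add: ennreal_mult mult_ac add_ac)
        finally have "ennreal (p u) * (\<integral>\<^sup>+y. ennreal (q y) * indicator A ((y - n u) / m u) \<partial>lborel)
           = (\<integral>\<^sup>+x. ennreal (p u) * (ennreal (m u * q (m u * x + n u)) * indicator A x) \<partial>lborel)"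
          by (simp add: nn_integral_cmult)
        then show ?thesis using True p mu q
          by (simp add: ennreal_mult mult_ac)
      qed
    qed
    also have "\<dots> = ?R"
      by (simp add: nn_integral_density_measure)
    finally show ?thesis .
  qed
  have "(\<integral>\<^sup>+x. H x \<partial>lborel) = emeasure (density_measure p) UNIV * emeasure (density_measure q) UNIV"
    using *[of UNIV] by (simp add: mult.commute)
  also have "\<dots> < \<infinity>"
    by (simp add: P.emeasure_eq_measure Q.emeasure_eq_measure ennreal_mult_less_top)
  finally have "AE x in lborel. H x \<noteq> \<infinity>"
    by (intro nn_integral_PInf_AE) auto
  then have ae: "AE x in lborel. ennreal (h x) = H x"
  proof eventually_elim
    case (elim x)
    have "integrable lborel (\<lambda>u. indicator {0<..} u * (p u * (m u * q (m u * x + n u))))"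
      using elim nonneg unfolding H_def by (intro integrableI_nonneg) (auto simp: less_top)
    then show ?case
      using nonneg unfolding H_def h' by (subst nn_integral_eq_integral) auto
  qed
  show "density_measure h =
       distr (density_measure p \<Otimes>\<^sub>M density_measure q) borel (\<lambda>(u, y). (y - n u) / m u)"
  proof (rule measure_eqI)
    fix A assume "A \<in> sets (density_measure h)"
    then have [measurable]: "A \<in> sets borel" by simp
    have "emeasure (density_measure h) A = (\<integral>\<^sup>+x. ennreal (h x) * indicator A x \<partial>lborel)"
      unfolding density_measure_def by (subst emeasure_density) auto
    also have "\<dots> = (\<integral>\<^sup>+x. H x * indicator A x \<partial>lborel)"
      using ae by (intro nn_integral_cong_AE) auto
    also have "\<dots> = (\<integral>\<^sup>+z. indicator A (case z of (u, y) \<Rightarrow> (y - n u) / m u) \<partial>(density_measure p \<Otimes>\<^sub>M density_measure q))"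
      by (subst *) (simp_all add: Q.nn_integral_fst[symmetric])
    also have "\<dots> = emeasure (distr (density_measure p \<Otimes>\<^sub>M density_measure q) borel (\<lambda>(u, y). (y - n u) / m u)) A"
      by (subst nn_integral_distr[symmetric, where f = "indicator A" and M' = borel]) simp_all
    finally show "emeasure (density_measure h) A = \<dots>" .
  qed simp
qed

text \<open>The factor \<open>1 / u\<close> of the Mellin convolution is exactly the Jacobian of
  \<open>y = x / u\<close>.\<close>

lemma density_measure_mellin_conv:
  assumes "f \<in> borel_measurable borel" "g \<in> borel_measurable borel"
    and "\<And>u. f u \<ge> 0" "\<And>u. u \<le> 0 \<Longrightarrow> f u = 0" "\<And>y. g y \<ge> 0"
    and "finite_measure (density_measure f)" "finite_measure (density_measure g)"
  shows "mellin_conv f g \<in> borel_measurable borel" "\<And>x. mellin_conv f g x \<ge> 0"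
    "density_measure (mellin_conv f g) =
       distr (density_measure f \<Otimes>\<^sub>M density_measure g) borel (\<lambda>(u, y). u * y)"
proof -
  have "mellin_conv f g x = (LBINT u:{0<..}. f u * (1 / u * g (1 / u * x + 0)))" for x
    by (simp add: mellin_conv_def)
  note * = density_measure_affine_kernel[where m = "\<lambda>u. 1 / u" and n = "\<lambda>_. 0",
      OF assms(1,2) _ _ assms(3-5) _ assms(6,7) this]
  show "mellin_conv f g \<in> borel_measurable borel" "\<And>x. mellin_conv f g x \<ge> 0"
    by (rule *; simp)+
  have "(\<lambda>(u, y). (y - 0) / (1 / u)) = (\<lambda>(u, y). u * y :: real)"
    by auto
  then show "density_measure (mellin_conv f g) =
       distr (density_measure f \<Otimes>\<^sub>M density_measure g) borel (\<lambda>(u, y). u * y)"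
    by (subst *(3)) simp_all
qed

definition gamma_density :: "real \<Rightarrow> real \<Rightarrow> real \<Rightarrow> real" where
  "gamma_density \<rho> d u = (if 0 < u then \<rho> powr d / Gamma d * u powr (d - 1) * exp (- \<rho> * u) else 0)"

lemma gamma_density_measurable [measurable]: "gamma_density \<rho> d \<in> borel_measurable borel"
  unfolding gamma_density_def by measurable

lemma gamma_density_nonneg: "d > 0 \<Longrightarrow> \<rho> > 0 \<Longrightarrow> gamma_density \<rho> d u \<ge> 0"
  by (auto simp: gamma_density_def intro!: mult_nonneg_nonneg divide_nonneg_nonneg less_imp_le[OF Gamma_real_pos])

lemma gamma_density_nonpos: "u \<le> 0 \<Longrightarrow> gamma_density \<rho> d u = 0"
  by (simp add: gamma_density_def)

text \<open>\<open>K_op\<close> evaluates \<open>f\<close> at \<open>t + u\<close>, so the Gamma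
  variable is subtracted; this is where the alternating signs in \<open>gamma_egf\<close> come
  from.\<close>

lemma density_measure_K_op:
  assumes "f \<in> borel_measurable borel" "\<And>t. f t \<ge> 0" "finite_measure (density_measure f)"
    and "\<rho> > 0" "d > 0" "finite_measure (density_measure (gamma_density \<rho> d))"
  shows "K_op \<rho> d f \<in> borel_measurable borel" "\<And>t. K_op \<rho> d f t \<ge> 0"
    "density_measure (K_op \<rho> d f) =
       distr (density_measure (gamma_density \<rho> d) \<Otimes>\<^sub>M density_measure f) borel (\<lambda>(u, y). y - u)"
proof -
  have "K_op \<rho> d f x = (LBINT u:{0<..}. gamma_density \<rho> d u * (1 * f (1 * x + u)))" for x
    unfolding K_op_def set_lebesgue_integral_def if_not_P[OF less_imp_neq[OF assms(5), symmetric]]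
    by (rule Bochner_Integration.integral_cong[OF refl])
      (simp add: gamma_density_def split: split_indicator)
  note * = density_measure_affine_kernel[where m = "\<lambda>_. 1" and n = "\<lambda>u. u", OF gamma_density_measurable assms(1)
      _ _ gamma_density_nonneg[OF assms(5,4)] gamma_density_nonpos assms(2) _ assms(6,3) this]
  show "K_op \<rho> d f \<in> borel_measurable borel" "\<And>x. K_op \<rho> d f x \<ge> 0"
    by (rule *; simp)+
  show "density_measure (K_op \<rho> d f) =
       distr (density_measure (gamma_density \<rho> d) \<Otimes>\<^sub>M density_measure f) borel (\<lambda>(u, y). y - u)"
    by (subst *(3)) simp_all
qed

section \<open>Moments of products\<close>

lemma
  fixes f g :: "real \<Rightarrow> real"
  assumes "finite_measure A" "finite_measure B" and f: "integrable A f" and g: "integrable B g"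
  shows integrable_pair_mult: "integrable (A \<Otimes>\<^sub>M B) (\<lambda>z. f (fst z) * g (snd z))"
    and integral_pair_mult:
      "(LINT z|(A \<Otimes>\<^sub>M B). f (fst z) * g (snd z)) = integral\<^sup>L A f * integral\<^sup>L B g"
proof -
  interpret A: finite_measure A by fact
  interpret B: finite_measure B by fact
  interpret pair_sigma_finite A B ..
  have [measurable]: "f \<in> borel_measurable A" "g \<in> borel_measurable B"
    using f g by auto
  show *: "integrable (A \<Otimes>\<^sub>M B) (\<lambda>z. f (fst z) * g (snd z))"
    using f g by (intro Fubini_integrable) (auto simp: abs_mult)
  show "(LINT z|(A \<Otimes>\<^sub>M B). f (fst z) * g (snd z)) = integral\<^sup>L A f * integral\<^sup>L B g"
    using integral_fst'[OF *] by simp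
qed

lemma integrable_density_measure:
  fixes f g :: "real \<Rightarrow> real"
  assumes "f \<in> borel_measurable borel" "\<And>x. f x \<ge> 0" "g \<in> borel_measurable borel"
  shows "integrable (density_measure f) g \<longleftrightarrow> integrable lborel (\<lambda>x. f x * g x)"
  using assms unfolding density_measure_def by (subst integrable_density) auto

lemma integral_density_measure:
  fixes f g :: "real \<Rightarrow> real"
  assumes "f \<in> borel_measurable borel" "\<And>x. f x \<ge> 0" "g \<in> borel_measurable borel"
  shows "integral\<^sup>L (density_measure f) g = (LBINT x. f x * g x)"
  using assms unfolding density_measure_def by (subst integral_density) auto

lemma finite_measure_density_measure:
  assumes f: "f \<in> borel_measurable borel" "\<And>x. f x \<ge> 0" "has_bochner_integral lborel f I"
  shows "finite_measure (density_measure f)" "measure (density_measure f) UNIV = I"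
proof -
  have I: "I \<ge> 0" using f(2,3) by (auto simp: has_bochner_integral_iff intro!: integral_nonneg_AE)
  have "emeasure (density_measure f) UNIV = (\<integral>\<^sup>+x. f x \<partial>lborel)"
    unfolding density_measure_def using f by (subst emeasure_density) auto
  also have "\<dots> = ennreal I"
    using f by (subst nn_integral_eq_integral) (auto simp: has_bochner_integral_iff)
  finally have *: "emeasure (density_measure f) UNIV = ennreal I" .
  show "finite_measure (density_measure f)" by (rule finite_measureI) (simp add: *)
  show "measure (density_measure f) UNIV = I" using I by (simp add: measure_def *)
qed

text \<open>The weights are not normalised, so products are formed with finite measures; positive
  mass makes the later division by it meaningful.\<close>

definition pos_moments :: "real measure \<Rightarrow> bool" where
  "pos_moments M \<longleftrightarrow> sets M = sets borel \<and> finite_measure M \<and> measure M UNIV > 0 \<and>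
     (\<forall>k. integrable M (\<lambda>x. x ^ k))"

text \<open>Moments of the normalised measure in the coordinate \<open>t\<close> given by
  \<open>x = c * (1 + e * t)\<close>. Beta factors use \<open>c = 1\<close>; the Gamma factor and
  all partial products use \<open>c = \<tau>\<close>.\<close>

definition std_moment :: "real \<Rightarrow> real \<Rightarrow> real measure \<Rightarrow> nat \<Rightarrow> real" where
  "std_moment c e M k = (LINT x|M. ((x / c - 1) / e) ^ k) / measure M UNIV"

text \<open>The factor \<open>x ^ i\<close> is there for the integrals in Stein's identity.\<close>

lemma integrable_affine_power:
  fixes \<alpha> \<beta> :: real
  assumes "\<And>k. integrable M (\<lambda>x. x ^ k)"
  shows "integrable M (\<lambda>x. x ^ i * (\<beta> * x + \<alpha>) ^ k)"
proof -
  have "(\<lambda>x. x ^ i * (\<beta> * x + \<alpha>) ^ k) = (\<lambda>x. \<Sum>j\<le>k. (of_nat (k choose j) * \<beta> ^ j * \<alpha> ^ (k - j)) * x ^ (i + j))"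
    by (rule ext) (simp add: binomial_ring sum_distrib_left power_mult_distrib power_add mult_ac)
  then show ?thesis using assms by simp
qed

lemma integrable_std_power:
  fixes c e :: real
  assumes "pos_moments M"
  shows "integrable M (\<lambda>x. ((x / c - 1) / e) ^ k)"
proof -
  have "integrable M (\<lambda>x. x ^ 0 * (1 / (c * e) * x + (- (1 / e))) ^ k)"
    using assms by (intro integrable_affine_power) (simp add: pos_moments_def)
  moreover have "(\<lambda>x. x ^ 0 * (1 / (c * e) * x + (- (1 / e))) ^ k) = (\<lambda>x. ((x / c - 1) / e) ^ k)"
    by (simp add: diff_divide_distrib)
  ultimately show ?thesis by simp
qed

text \<open>Writing \<open>u = 1 + e s\<close> and \<open>y = c (1 + e t)\<close>, one has \<open>u y = c (1 + e (s (1 + e t) + t))\<close>.\<close>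

lemma product_pos_moments:
  assumes A: "pos_moments A" and B: "pos_moments B"
    and M: "M = distr (A \<Otimes>\<^sub>M B) borel (\<lambda>(u, y). u * y)"
  shows "pos_moments M" "measure M UNIV = measure A UNIV * measure B UNIV"
    "c \<noteq> 0 \<Longrightarrow> e \<noteq> 0 \<Longrightarrow> std_moment c e M k = (\<Sum>j\<le>k. \<Sum>i\<le>j. of_nat (k choose j) * of_nat (j choose i) * e ^ i *
        (std_moment 1 e A j * std_moment c e B (k - j + i)))"
proof -
  have [measurable_cong]: "sets A = sets borel" "sets B = sets borel"
    using A B by (auto simp: pos_moments_def)
  have fin: "finite_measure A" "finite_measure B" using A B by (auto simp: pos_moments_def)
  interpret A: finite_measure A by fact
  interpret B: finite_measure B by fact
  interpret P: pair_sigma_finite A B ..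
  have sp: "space A = UNIV" "space B = UNIV"
    using A B by (auto simp: pos_moments_def dest: sets_eq_imp_space_eq)
  have [measurable]: "(\<lambda>(u, y). u * y) \<in> borel_measurable (A \<Otimes>\<^sub>M B)" by measurable
  have "emeasure M UNIV = emeasure (A \<Otimes>\<^sub>M B) (UNIV \<times> UNIV)"
    unfolding M by (subst emeasure_distr) (auto simp: space_pair_measure sp)
  also have "\<dots> = emeasure A UNIV * emeasure B UNIV"
    using sets.top[of A] sets.top[of B] by (subst B.emeasure_pair_measure_Times) (auto simp: sp)
  also have "\<dots> = ennreal (measure A UNIV * measure B UNIV)"
    by (simp add: A.emeasure_eq_measure B.emeasure_eq_measure ennreal_mult)
  finally have mass: "emeasure M UNIV = ennreal (measure A UNIV * measure B UNIV)" .
  then show mass': "measure M UNIV = measure A UNIV * measure B UNIV" by (simp add: measure_def)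
  have setsM: "sets M = sets borel" by (simp add: M)
  have spM: "space M = UNIV" by (simp add: M)
  have finM: "finite_measure M" by (rule finite_measureI) (simp add: mass spM)
  have "integrable M (\<lambda>x. x ^ k)" for k
    using integrable_pair_mult[OF fin, of "\<lambda>x. x ^ k" "\<lambda>x. x ^ k"] A B
    unfolding M by (subst integrable_distr_eq) (auto simp: pos_moments_def case_prod_beta power_mult_distrib)
  then show "pos_moments M"
    using A B finM setsM by (simp add: pos_moments_def mass')
  show "std_moment c e M k = (\<Sum>j\<le>k. \<Sum>i\<le>j. of_nat (k choose j) * of_nat (j choose i) * e ^ i *
        (std_moment 1 e A j * std_moment c e B (k - j + i)))" if ce: "c \<noteq> 0" "e \<noteq> 0"
  proof -
    define s t :: "real \<Rightarrow> real" where "s u = (u / 1 - 1) / e" and "t y = (y / c - 1) / e" for u y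
    have int: "integrable A (\<lambda>u. s u ^ k)" "integrable B (\<lambda>y. t y ^ k)" for k
      unfolding s_def t_def by (intro integrable_std_power A B)+
    have expand: "((u * y / c - 1) / e) ^ k = (\<Sum>j\<le>k. \<Sum>i\<le>j. of_nat (k choose j) * of_nat (j choose i) * e ^ i *
        (s u ^ j * t y ^ (k - j + i)))" for u y
    proof -
      have "(u * y / c - 1) / e = s u * (e * t y + 1) + t y"
        using ce by (simp add: s_def t_def field_simps)
      also have "\<dots> ^ k = (\<Sum>j\<le>k. of_nat (k choose j) * (s u * (e * t y + 1)) ^ j * t y ^ (k - j))"
        by (rule binomial_ring)
      also have "\<dots> = (\<Sum>j\<le>k. \<Sum>i\<le>j. of_nat (k choose j) * of_nat (j choose i) * e ^ i *
        (s u ^ j * t y ^ (k - j + i)))"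
        by (intro sum.cong refl)
          (simp only: power_mult_distrib binomial_ring sum_distrib_left sum_distrib_right power_add
              power_one mult_1_right mult_1_left mult_ac)
      finally show ?thesis .
    qed
    have "(LINT x|M. ((x / c - 1) / e) ^ k)
      = (LINT z|(A \<Otimes>\<^sub>M B). (\<Sum>j\<le>k. \<Sum>i\<le>j. of_nat (k choose j) * of_nat (j choose i) * e ^ i *
        (s (fst z) ^ j * t (snd z) ^ (k - j + i))))"
      unfolding M by (subst integral_distr) (auto simp: case_prod_beta expand)
    also have "\<dots> = (\<Sum>j\<le>k. \<Sum>i\<le>j. of_nat (k choose j) * of_nat (j choose i) * e ^ i *
        ((LINT u|A. s u ^ j) * (LINT y|B. t y ^ (k - j + i))))"
      using integrable_pair_mult[OF fin int] integral_pair_mult[OF fin int]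
      by (subst Bochner_Integration.integral_sum) (auto simp: Bochner_Integration.integral_sum)
    finally show ?thesis
      unfolding std_moment_def mass' s_def t_def by (simp add: sum_divide_distrib)
  qed
qed

text \<open>The limit moments are stored in a formal power series, whose convergence is not asked
  for. Adding independent variables then becomes multiplication of series.\<close>

definition std_moments_tendsto :: "(real \<Rightarrow> real) \<Rightarrow> (real \<Rightarrow> real measure) \<Rightarrow> real fps \<Rightarrow> bool" where
  "std_moments_tendsto c M F \<longleftrightarrow> (\<forall>\<^sub>F \<tau> in at_top. pos_moments (M \<tau>)) \<and>
     (\<forall>k. ((\<lambda>\<tau>. std_moment (c \<tau>) (scale_eps \<tau>) (M \<tau>) k) \<longlongrightarrow> fact k * fps_nth F k) at_top)"

lemma scale_eps_tendsto_0: "(scale_eps \<longlongrightarrow> 0) at_top"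
proof -
  have "((\<lambda>\<tau>. sqrt (2 / \<tau>)) \<longlongrightarrow> sqrt 0) at_top"
    by (intro tendsto_real_sqrt tendsto_divide_0[OF tendsto_const] filterlim_at_top_imp_at_infinity filterlim_ident)
  then show ?thesis by (simp add: scale_eps_def[abs_def])
qed

lemma egf_mult_nth:
  fixes F G :: "real fps"
  shows "fact k * fps_nth (F * G) k =
    (\<Sum>j\<le>k. of_nat (k choose j) * ((fact j * fps_nth F j) * (fact (k - j) * fps_nth G (k - j))))"
  unfolding fps_mult_nth sum_distrib_left
  by (intro sum.cong) (auto simp: binomial_fact field_simps)

text \<open>Every term of the expansion that uses the product \<open>s t\<close> carries a power of
  \<open>scale_eps\<close> and disappears. Such terms involve moments of \<open>B\<close> of order
  above \<open>k\<close>, so convergence of all orders has to be assumed together.\<close>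

lemma std_moments_tendsto_product:
  assumes A: "std_moments_tendsto (\<lambda>_. 1) A F" and B: "std_moments_tendsto c B G"
    and M: "\<forall>\<^sub>F \<tau> in at_top. M \<tau> = distr (A \<tau> \<Otimes>\<^sub>M B \<tau>) borel (\<lambda>(u, y). u * y)"
    and c: "\<forall>\<^sub>F \<tau> in at_top. c \<tau> \<noteq> 0"
  shows "std_moments_tendsto c M (F * G)"
  unfolding std_moments_tendsto_def
proof (intro conjI allI)
  have evA: "\<forall>\<^sub>F \<tau> in at_top. pos_moments (A \<tau>)" and evB: "\<forall>\<^sub>F \<tau> in at_top. pos_moments (B \<tau>)"
    using A B by (auto simp: std_moments_tendsto_def)
  show "\<forall>\<^sub>F \<tau> in at_top. pos_moments (M \<tau>)"
    using evA evB M by eventually_elim (rule product_pos_moments)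
  fix k
  have "((\<lambda>\<tau>. \<Sum>j\<le>k. \<Sum>i\<le>j. of_nat (k choose j) * of_nat (j choose i) * scale_eps \<tau> ^ i *
        (std_moment 1 (scale_eps \<tau>) (A \<tau>) j * std_moment (c \<tau>) (scale_eps \<tau>) (B \<tau>) (k - j + i)))
    \<longlongrightarrow> (\<Sum>j\<le>k. \<Sum>i\<le>j. of_nat (k choose j) * of_nat (j choose i) * 0 ^ i *
        ((fact j * fps_nth F j) * (fact (k - j + i) * fps_nth G (k - j + i))))) at_top"
    using A B by (intro tendsto_sum tendsto_mult tendsto_power tendsto_const scale_eps_tendsto_0)
      (auto simp: std_moments_tendsto_def)
  \<comment> \<open>As \<open>0 ^ 0 = 1\<close>, precisely the terms with \<open>i = 0\<close>
    survive; they form the binomial convolution.\<close>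
  also have "(\<Sum>j\<le>k. \<Sum>i\<le>j. of_nat (k choose j) * of_nat (j choose i) * 0 ^ i *
        ((fact j * fps_nth F j) * (fact (k - j + i) * fps_nth G (k - j + i)))) = fact k * fps_nth (F * G) k"
    unfolding egf_mult_nth
    by (intro sum.cong refl, subst sum.mono_neutral_right[where S = "{0}"]) auto
  finally have lim: "((\<lambda>\<tau>. \<Sum>j\<le>k. \<Sum>i\<le>j. of_nat (k choose j) * of_nat (j choose i) * scale_eps \<tau> ^ i *
        (std_moment 1 (scale_eps \<tau>) (A \<tau>) j * std_moment (c \<tau>) (scale_eps \<tau>) (B \<tau>) (k - j + i)))
    \<longlongrightarrow> fact k * fps_nth (F * G) k) at_top" .
  have "\<forall>\<^sub>F \<tau> in at_top. scale_eps \<tau> \<noteq> 0"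
    using eventually_gt_at_top[of 0] by eventually_elim (simp add: scale_eps_def)
  then have "\<forall>\<^sub>F \<tau> in at_top. (\<Sum>j\<le>k. \<Sum>i\<le>j. of_nat (k choose j) * of_nat (j choose i) * scale_eps \<tau> ^ i *
        (std_moment 1 (scale_eps \<tau>) (A \<tau>) j * std_moment (c \<tau>) (scale_eps \<tau>) (B \<tau>) (k - j + i)))
    = std_moment (c \<tau>) (scale_eps \<tau>) (M \<tau>) k"
    using evA evB M c by eventually_elim (simp add: product_pos_moments(3))
  with lim show "((\<lambda>\<tau>. std_moment (c \<tau>) (scale_eps \<tau>) (M \<tau>) k) \<longlongrightarrow> fact k * fps_nth (F * G) k) at_top"
    by (rule Lim_transform_eventually)
qed

section \<open>Beta and Gamma weights\<close>

lemma has_bochner_integral_real_nonneg: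
  fixes f :: "real \<Rightarrow> real"
  assumes "f \<in> borel_measurable borel" "\<And>x. f x \<ge> 0" "(\<integral>\<^sup>+x. f x \<partial>lborel) = ennreal I" "I \<ge> 0"
  shows "has_bochner_integral lborel f I"
  using assms by (intro has_bochner_integral_nn_integral) auto

lemma Gamma_real_nonzero: "x > 0 \<Longrightarrow> Gamma (x :: real) \<noteq> 0"
  by (metis Gamma_real_pos less_irrefl)

section \<open>The Beta factors: exact moments and their limits\<close>

lemma beta_weight_measurable [measurable]: "beta_weight a b \<in> borel_measurable borel"
  unfolding beta_weight_def by measurable

lemma beta_weight_nonneg: "a < b \<Longrightarrow> beta_weight a b x \<ge> 0"
  by (auto simp: beta_weight_def intro!: mult_nonneg_nonneg divide_nonneg_nonneg less_imp_le[OF Gamma_real_pos])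

lemma has_bochner_integral_beta_weight:
  assumes "a > -1" "b > a"
  shows "has_bochner_integral lborel (beta_weight a b) (Gamma (a + 1) / Gamma (b + 1))"
proof (rule has_bochner_integral_real_nonneg)
  have "((\<lambda>t. t powr (a + 1 - 1) * (1 - t) powr (b - a - 1)) has_integral Beta (a + 1) (b - a)) {0..1}"
    using assms by (intro has_integral_Beta_real) auto
  then have "((\<lambda>t. t powr (a + 1 - 1) * (1 - t) powr (b - a - 1) / Gamma (b - a))
      has_integral Beta (a + 1) (b - a) / Gamma (b - a)) {0..1}"
    by (rule has_integral_divide)
  then have "((\<lambda>t. if t \<in> {0..1} then t powr (a + 1 - 1) * (1 - t) powr (b - a - 1) / Gamma (b - a) else 0)
      has_integral Beta (a + 1) (b - a) / Gamma (b - a)) UNIV"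
    by (subst has_integral_restrict_UNIV)
  \<comment> \<open>The closed interval causes no discrepancy, since \<open>0 powr y = 0\<close>
    makes the integrand vanish at both endpoints.\<close>
  also have "(\<lambda>t. if t \<in> {0..1} then t powr (a + 1 - 1) * (1 - t) powr (b - a - 1) / Gamma (b - a) else 0) = beta_weight a b"
    by (rule ext) (auto simp: beta_weight_def)
  also have "Beta (a + 1) (b - a) / Gamma (b - a) = Gamma (a + 1) / Gamma (b + 1)"
    using assms Gamma_real_nonzero[of "b - a"] by (simp add: Beta_def add_ac)
  finally show "(\<integral>\<^sup>+x. beta_weight a b x \<partial>lborel) = ennreal (Gamma (a + 1) / Gamma (b + 1))"
    using assms by (intro nn_integral_has_integral_lborel) (auto simp: beta_weight_nonneg)
  show "Gamma (a + 1) / Gamma (b + 1) \<ge> 0"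
    using assms by (intro divide_nonneg_nonneg less_imp_le[OF Gamma_real_pos]) auto
qed (use assms in \<open>auto simp: beta_weight_nonneg\<close>)

lemma Gamma_shift_div: "z > 0 \<Longrightarrow> Gamma (z + of_nat k) / Gamma z = pochhammer z k" for z :: real
  by (subst pochhammer_Gamma) (auto elim: nonpos_Ints_cases)

text \<open>Multiplying by \<open>(1 - x) ^ k\<close> only raises \<open>b\<close> to
  \<open>b + k\<close>, up to a quotient of Gamma values. Moments about 1 therefore have a closed
  form, and 1 is the point about which the Beta factors concentrate.\<close>

lemma has_bochner_integral_beta_weight_moment:
  assumes "a > -1" "b > a"
  shows "has_bochner_integral lborel (\<lambda>x. beta_weight a b x * (1 - x) ^ k)
     (Gamma (a + 1) / Gamma (b + 1) * (pochhammer (b - a) k / pochhammer (b + 1) k))"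
proof -
  have "(\<lambda>x. beta_weight a b x * (1 - x) ^ k) = (\<lambda>x. pochhammer (b - a) k * beta_weight a (b + k) x)"
  proof
    fix x
    have "Gamma (b + k - a) = pochhammer (b - a) k * Gamma (b - a)"
      using assms Gamma_real_nonzero[of "b - a"] by (simp add: Gamma_shift_div[symmetric] algebra_simps)
    moreover have "pochhammer (b - a) k \<noteq> 0" using assms by (intro pochhammer_pos[THEN less_imp_neq, symmetric]) auto
    moreover have "(1 - x) powr (b + k - a - 1) = (1 - x) powr (b - a - 1) * (1 - x) ^ k" if "x < 1"
      using that by (subst powr_realpow[symmetric]) (auto simp: powr_add[symmetric] algebra_simps)
    ultimately show "beta_weight a b x * (1 - x) ^ k = pochhammer (b - a) k * beta_weight a (b + k) x"
      by (simp add: beta_weight_def)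
  qed
  moreover have "pochhammer (b - a) k * (Gamma (a + 1) / Gamma (b + k + 1))
    = Gamma (a + 1) / Gamma (b + 1) * (pochhammer (b - a) k / pochhammer (b + 1) k)"
    using assms Gamma_real_nonzero[of "b + 1"] by (simp add: Gamma_shift_div[symmetric] add_ac)
  moreover have "has_bochner_integral lborel (\<lambda>x. pochhammer (b - a) k * beta_weight a (b + k) x)
      (pochhammer (b - a) k * (Gamma (a + 1) / Gamma (b + k + 1)))"
    using assms by (intro has_bochner_integral_mult_right has_bochner_integral_beta_weight) auto
  ultimately show ?thesis by simp
qed

lemma beta_law:
  assumes "a > -1" "b > a"
  shows "pos_moments (density_measure (beta_weight a b))"
    "measure (density_measure (beta_weight a b)) UNIV = Gamma (a + 1) / Gamma (b + 1)"
    "e \<noteq> 0 \<Longrightarrow> std_moment 1 e (density_measure (beta_weight a b)) k =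
       (-1) ^ k * (pochhammer (b - a) k / (e ^ k * pochhammer (b + 1) k))"
proof -
  note * = finite_measure_density_measure[OF beta_weight_measurable beta_weight_nonneg[OF assms(2)]
      has_bochner_integral_beta_weight[OF assms]]
  show mass: "measure (density_measure (beta_weight a b)) UNIV = Gamma (a + 1) / Gamma (b + 1)" by fact
  have pos: "Gamma (a + 1) / Gamma (b + 1) > 0"
    using assms by (intro divide_pos_pos Gamma_real_pos) auto
  have "integrable lborel (\<lambda>x. beta_weight a b x * x ^ k)" for k
  proof (rule Bochner_Integration.integrable_bound)
    show "integrable lborel (beta_weight a b)"
      using has_bochner_integral_beta_weight[OF assms] by (auto simp: has_bochner_integral_iff)
    show "AE x in lborel. norm (beta_weight a b x * x ^ k) \<le> norm (beta_weight a b x)"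
      by (intro AE_I2) (auto simp: beta_weight_def abs_mult intro!: divide_right_mono mult_left_le power_le_one)
  qed measurable
  then show "pos_moments (density_measure (beta_weight a b))"
    using *(1) pos by (simp add: pos_moments_def mass integrable_density_measure beta_weight_nonneg assms)
  assume e: "e \<noteq> 0"
  have "(LINT x|density_measure (beta_weight a b). ((x / 1 - 1) / e) ^ k)
    = (LBINT x. ((-1) ^ k / e ^ k) * (beta_weight a b x * (1 - x) ^ k))"
  proof (subst integral_density_measure)
    show "(LBINT x. beta_weight a b x * ((x / 1 - 1) / e) ^ k) =
        (LBINT x. ((-1) ^ k / e ^ k) * (beta_weight a b x * (1 - x) ^ k))"
    proof (rule Bochner_Integration.integral_cong[OF refl])
      fix x :: real
      have "(x / 1 - 1) ^ k = (-1) ^ k * (1 - x) ^ k"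
        by (subst power_mult_distrib[symmetric]) simp
      then show "beta_weight a b x * ((x / 1 - 1) / e) ^ k = ((-1) ^ k / e ^ k) * (beta_weight a b x * (1 - x) ^ k)"
        by (simp add: power_divide)
    qed
  qed (use assms in \<open>auto simp: beta_weight_nonneg\<close>)
  also have "\<dots> = ((-1) ^ k / e ^ k) * (Gamma (a + 1) / Gamma (b + 1) * (pochhammer (b - a) k / pochhammer (b + 1) k))"
    using has_bochner_integral_beta_weight_moment[OF assms, of k]
    by (subst integral_mult_right_zero) (simp add: has_bochner_integral_iff)
  finally show "std_moment 1 e (density_measure (beta_weight a b)) k =
       (-1) ^ k * (pochhammer (b - a) k / (e ^ k * pochhammer (b + 1) k))"
    using assms Gamma_real_nonzero[of "a + 1"] Gamma_real_nonzero[of "b + 1"] by (simp add: std_moment_def mass)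
qed

text \<open>The binomial series of \<open>(1 + z / \<rho>) powr (- d)\<close>, the moment generating
  function of minus a Gamma variable of shape \<open>d\<close> and rate \<open>\<rho>\<close>. At
  \<open>d = 0\<close> it is the constant 1.\<close>

definition gamma_egf :: "real \<Rightarrow> real \<Rightarrow> real fps" where
  "gamma_egf \<rho> d = Abs_fps (\<lambda>k. (-1) ^ k * pochhammer d k / (\<rho> ^ k * fact k))"

lemma beta_law_tendsto:
  assumes ab: "\<forall>\<^sub>F \<tau> in at_top. a \<tau> > -1 \<and> b \<tau> > a \<tau>"
    and a: "((\<lambda>\<tau>. scale_eps \<tau> * (a \<tau> + 1)) \<longlongrightarrow> \<rho>) at_top" and \<rho>: "\<rho> > 0"
    and b: "((\<lambda>\<tau>. b \<tau> - a \<tau>) \<longlongrightarrow> d) at_top"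
  shows "std_moments_tendsto (\<lambda>_. 1) (\<lambda>\<tau>. density_measure (beta_weight (a \<tau>) (b \<tau>))) (gamma_egf \<rho> d)"
  unfolding std_moments_tendsto_def
proof (intro conjI allI)
  show "\<forall>\<^sub>F \<tau> in at_top. pos_moments (density_measure (beta_weight (a \<tau>) (b \<tau>)))"
    using ab by eventually_elim (auto intro: beta_law)
  fix k
  \<comment> \<open>Because \<open>b - a\<close> has a finite limit, exchanging \<open>a\<close> for
    \<open>b\<close> and adding \<open>i\<close> changes the product with \<open>scale_eps\<close>
    only by a null sequence; every factor of the rising factorial below thus has the same
    limit.\<close>
  have "((\<lambda>\<tau>. scale_eps \<tau> * (a \<tau> + 1) + scale_eps \<tau> * ((b \<tau> - a \<tau>) + real i)) \<longlongrightarrow> \<rho> + 0 * (d + real i)) at_top" for i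
    by (intro tendsto_intros a b scale_eps_tendsto_0)
  then have 1: "((\<lambda>\<tau>. scale_eps \<tau> * (b \<tau> + 1 + real i)) \<longlongrightarrow> \<rho>) at_top" for i
    by (simp add: algebra_simps)
  have "((\<lambda>\<tau>. (-1) ^ k * ((\<Prod>i<k. b \<tau> - a \<tau> + real i) / (\<Prod>i<k. scale_eps \<tau> * (b \<tau> + 1 + real i))))
      \<longlongrightarrow> (-1) ^ k * ((\<Prod>i<k. d + real i) / (\<Prod>i<k. \<rho>))) at_top"
    using \<rho> by (intro tendsto_intros b 1) auto
  then have lim: "((\<lambda>\<tau>. (-1) ^ k * (pochhammer (b \<tau> - a \<tau>) k / (scale_eps \<tau> ^ k * pochhammer (b \<tau> + 1) k)))
      \<longlongrightarrow> fact k * fps_nth (gamma_egf \<rho> d) k) at_top"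
    by (simp add: gamma_egf_def pochhammer_prod atLeast0LessThan prod.distrib)
  have "\<forall>\<^sub>F \<tau> in at_top. scale_eps \<tau> \<noteq> 0"
    using eventually_gt_at_top[of 0] by eventually_elim (simp add: scale_eps_def)
  then have "\<forall>\<^sub>F \<tau> in at_top. (-1) ^ k * (pochhammer (b \<tau> - a \<tau>) k / (scale_eps \<tau> ^ k * pochhammer (b \<tau> + 1) k))
     = std_moment 1 (scale_eps \<tau>) (density_measure (beta_weight (a \<tau>) (b \<tau>))) k"
    using ab by eventually_elim (simp add: beta_law)
  with lim show "((\<lambda>\<tau>. std_moment 1 (scale_eps \<tau>) (density_measure (beta_weight (a \<tau>) (b \<tau>))) k)
     \<longlongrightarrow> fact k * fps_nth (gamma_egf \<rho> d) k) at_top"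
    by (rule Lim_transform_eventually)
qed

text \<open>Addition of exponents of \<open>1 + z / \<rho>\<close>; coefficientwise it is
  Vandermonde's identity for rising factorials.\<close>

lemma gamma_egf_add_one:
  assumes "\<rho> \<noteq> 0"
  shows "gamma_egf \<rho> d * gamma_egf \<rho> 1 = gamma_egf \<rho> (d + 1)"
proof (rule fps_ext)
  fix k
  have "fact k * fps_nth (gamma_egf \<rho> d * gamma_egf \<rho> 1) k
    = (\<Sum>j\<le>k. ((-1) ^ k / \<rho> ^ k) * (of_nat (k choose j) * pochhammer d j * pochhammer 1 (k - j)))"
    unfolding egf_mult_nth
  proof (intro sum.cong refl)
    fix j assume "j \<in> {..k}"
    then have "(-1) ^ k = (-1) ^ j * (-1 :: real) ^ (k - j)" "\<rho> ^ k = \<rho> ^ j * \<rho> ^ (k - j)"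
      by (auto simp: power_add[symmetric])
    then show "real (k choose j) * (fact j * fps_nth (gamma_egf \<rho> d) j * (fact (k - j) * fps_nth (gamma_egf \<rho> 1) (k - j)))
      = ((-1) ^ k / \<rho> ^ k) * (of_nat (k choose j) * pochhammer d j * pochhammer 1 (k - j))"
      by (simp add: gamma_egf_def)
  qed
  also have "\<dots> = ((-1) ^ k / \<rho> ^ k) * pochhammer (d + 1) k"
    by (simp only: sum_distrib_left[symmetric] pochhammer_binomial_sum)
  also have "\<dots> = fact k * fps_nth (gamma_egf \<rho> (d + 1)) k"
    by (simp add: gamma_egf_def)
  finally show "fps_nth (gamma_egf \<rho> d * gamma_egf \<rho> 1) k = fps_nth (gamma_egf \<rho> (d + 1)) k"
    by simp
qed

section \<open>The Gamma factor: Stein recurrence and Gaussian limit\<close>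

lemma gamma_weight_measurable [measurable]: "gamma_weight a \<in> borel_measurable borel"
  unfolding gamma_weight_def by measurable

lemma gamma_weight_nonneg: "gamma_weight a x \<ge> 0"
  by (auto simp: gamma_weight_def)

lemma has_bochner_integral_gamma_weight:
  assumes "a > -1"
  shows "has_bochner_integral lborel (gamma_weight a) (Gamma (a + 1))"
proof (rule has_bochner_integral_real_nonneg)
  have "gamma_weight a = (\<lambda>t. indicator {0..} t * t powr (a + 1 - 1) / exp t)"
    by (rule ext) (auto simp: gamma_weight_def exp_minus field_simps split: split_indicator)
  then show "(\<integral>\<^sup>+x. gamma_weight a x \<partial>lborel) = ennreal (Gamma (a + 1))"
    using Gamma_conv_nn_integral_real[of "a + 1"] assms by simp
qed (use assms in \<open>auto simp: gamma_weight_nonneg intro!: less_imp_le[OF Gamma_real_pos]\<close>)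

lemma has_bochner_integral_gamma_weight_moment:
  assumes "a > -1"
  shows "has_bochner_integral lborel (\<lambda>x. gamma_weight a x * x ^ k) (Gamma (a + 1) * pochhammer (a + 1) k)"
proof -
  have "(\<lambda>x. gamma_weight a x * x ^ k) = gamma_weight (a + k)"
    by (rule ext) (auto simp: gamma_weight_def powr_add powr_realpow)
  moreover have "Gamma (a + k + 1) = Gamma (a + 1) * pochhammer (a + 1) k"
    using assms Gamma_real_nonzero[of "a + 1"] by (simp add: Gamma_shift_div[symmetric] add_ac)
  ultimately show ?thesis
    using has_bochner_integral_gamma_weight[of "a + k"] assms by simp
qed

lemma gamma_law:
  assumes "a > -1"
  shows "pos_moments (density_measure (gamma_weight a))"
    "measure (density_measure (gamma_weight a)) UNIV = Gamma (a + 1)"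
    "(LINT x|density_measure (gamma_weight a). x ^ k) = Gamma (a + 1) * pochhammer (a + 1) k"
proof -
  note * = finite_measure_density_measure[OF gamma_weight_measurable gamma_weight_nonneg
      has_bochner_integral_gamma_weight[OF assms]]
  have moment: "integrable lborel (\<lambda>x. gamma_weight a x * x ^ k)"
      "(LBINT x. gamma_weight a x * x ^ k) = Gamma (a + 1) * pochhammer (a + 1) k" for k
    using has_bochner_integral_gamma_weight_moment[OF assms, of k] by (auto simp: has_bochner_integral_iff)
  show "measure (density_measure (gamma_weight a)) UNIV = Gamma (a + 1)" by fact
  then show "pos_moments (density_measure (gamma_weight a))"
    using *(1) moment assms
    by (simp add: pos_moments_def integrable_density_measure gamma_weight_nonneg)
  show "(LINT x|density_measure (gamma_weight a). x ^ k) = Gamma (a + 1) * pochhammer (a + 1) k"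
    using moment by (simp add: integral_density_measure gamma_weight_nonneg)
qed

text \<open>Stein's identity \<open>E[X f(X)] = \<alpha> E[f(X)] + E[X f'(X)]\<close> of the Gamma distribution, for
  \<open>f(x) = x ^ i * (\<beta> x + \<gamma>) ^ k\<close>; the extra power of \<open>x\<close> makes the induction go through.\<close>

lemma gamma_stein:
  fixes a \<beta> \<gamma> :: real and i k :: nat
  assumes "a > -1"
  defines "J \<equiv> \<lambda>(i::nat) (k::nat). LINT x|density_measure (gamma_weight a). x ^ i * (\<beta> * x + \<gamma>) ^ k"
  shows "J (Suc i) k = (a + 1 + i) * J i k + k * \<beta> * J (Suc i) (k - 1)"
proof -
  have int: "integrable (density_measure (gamma_weight a)) (\<lambda>x. x ^ i * (\<beta> * x + \<gamma>) ^ k)" for i k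
    using gamma_law(1)[OF assms(1)] by (intro integrable_affine_power) (simp add: pos_moments_def)
  have step: "J i (Suc k) = \<beta> * J (Suc i) k + \<gamma> * J i k" for i k
  proof -
    have "(\<lambda>x. x ^ i * (\<beta> * x + \<gamma>) ^ Suc k) =
      (\<lambda>x. \<beta> * (x ^ Suc i * (\<beta> * x + \<gamma>) ^ k) + \<gamma> * (x ^ i * (\<beta> * x + \<gamma>) ^ k))"
      by (rule ext) (simp add: algebra_simps)
    then show ?thesis
      unfolding J_def using int[of "Suc i" k] int[of i k] by simp
  qed
  have zero: "J (Suc i) 0 = (a + 1 + i) * J i 0" for i
    unfolding J_def power_0 mult_1_right gamma_law(3)[OF assms(1)]
    by (simp add: pochhammer_Suc)
  show ?thesis
  proof (induction k arbitrary: i)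
    case 0
    show ?case using zero by simp
  next
    case (Suc k)
    \<comment> \<open>At \<open>k = 0\<close> truncated subtraction turns \<open>k - 1\<close> into
      0, and the factor \<open>k\<close> removes the term.\<close>
    have last: "k * \<beta> * (\<beta> * J (Suc (Suc i)) (k - 1) + \<gamma> * J (Suc i) (k - 1)) = k * \<beta> * J (Suc i) k"
    proof (cases k)
      case (Suc l)
      then show ?thesis using step[of "Suc i" l] by simp
    qed simp
    have "J (Suc i) (Suc k) = \<beta> * J (Suc (Suc i)) k + \<gamma> * J (Suc i) k"
      by (rule step)
    also have "\<dots> = \<beta> * ((a + 1 + Suc i) * J (Suc i) k + k * \<beta> * J (Suc (Suc i)) (k - 1))
        + \<gamma> * ((a + 1 + i) * J i k + k * \<beta> * J (Suc i) (k - 1))"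
      unfolding Suc.IH[symmetric] ..
    also have "\<dots> = (a + 1 + i) * (\<beta> * J (Suc i) k + \<gamma> * J i k) + \<beta> * J (Suc i) k
        + k * \<beta> * (\<beta> * J (Suc (Suc i)) (k - 1) + \<gamma> * J (Suc i) (k - 1))"
      by (simp add: algebra_simps)
    also have "\<dots> = (a + 1 + i) * J i (Suc k) + Suc k * \<beta> * J (Suc i) (Suc k - 1)"
      unfolding last unfolding step[symmetric] by (simp add: algebra_simps)
    finally show ?case .
  qed
qed

text \<open>The series of \<open>exp (z^2 / 4) * exp (m * z)\<close>, the moment generating function
  of a Gaussian with mean \<open>m\<close> and variance 1/2.\<close>

definition gauss_egf :: "real \<Rightarrow> real fps" where
  "gauss_egf m = Abs_fps (\<lambda>k. if even k then 1 / (4 ^ (k div 2) * fact (k div 2)) else 0) * fps_exp m"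

text \<open>Stein's identity for powers of the centred variable. When
  \<open>\<alpha> / (\<tau> * e)\<^sup>2\<close> tends to 1/2 and \<open>1 / (\<tau> * e)\<close> to
  0, what remains is the moment recurrence of a centred Gaussian with variance 1/2.\<close>

lemma gamma_central_recurrence:
  fixes \<tau> e \<alpha> :: real and k :: nat
  assumes "\<alpha> > 0" "\<tau> > 0" "e > 0"
  defines "m \<equiv> \<lambda>k. (LINT x|density_measure (gamma_weight (\<alpha> - 1)). ((x - \<alpha>) / (\<tau> * e)) ^ k) / Gamma \<alpha>"
  shows "m 0 = 1" "m (Suc 0) = 0"
    "m (Suc (Suc k)) = (k + 1) * (\<alpha> / (\<tau> * e)\<^sup>2 * m k + 1 / (\<tau> * e) * m (Suc k))"
proof -
  define w where "w = \<tau> * e"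
  have w: "w > 0" using assms by (simp add: w_def)
  have a: "\<alpha> - 1 > -1" using assms by simp
  have G: "Gamma \<alpha> > 0" using assms by simp
  have int: "integrable (density_measure (gamma_weight (\<alpha> - 1))) (\<lambda>x. x ^ i * (1 / w * x + (- \<alpha> / w)) ^ k)" for i k
    using gamma_law(1)[OF a] by (intro integrable_affine_power) (simp add: pos_moments_def)
  define J where "J i k = (LINT x|density_measure (gamma_weight (\<alpha> - 1)). x ^ i * (1 / w * x + (- \<alpha> / w)) ^ k)" for i k
  have mJ: "m k = J 0 k / Gamma \<alpha>" for k
    by (simp add: m_def J_def w_def diff_divide_distrib)
  have J1: "J 1 k = w * J 0 (Suc k) + \<alpha> * J 0 k" for k
  proof -
    have "(\<lambda>x. x ^ 1 * (1 / w * x + (- \<alpha> / w)) ^ k) =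
      (\<lambda>x. w * (x ^ 0 * (1 / w * x + (- \<alpha> / w)) ^ Suc k) + \<alpha> * (x ^ 0 * (1 / w * x + (- \<alpha> / w)) ^ k))"
      using w by (intro ext) (simp add: field_simps)
    then show ?thesis
      unfolding J_def using int[of 0 "Suc k"] int[of 0 k] by simp
  qed
  have st: "J 1 k = \<alpha> * J 0 k + k * (1 / w) * J 1 (k - 1)" for k
    using gamma_stein[OF a, of 0 "1 / w" "- \<alpha> / w" k] by (simp add: J_def)
  \<comment> \<open>Centring at the mean \<open>\<alpha>\<close> makes the two terms
    \<open>\<alpha> * J 0 k\<close> cancel, so the recurrence has no first-order drift.\<close>
  have rec: "w * J 0 (Suc k) = k * (1 / w) * J 1 (k - 1)" for k
    using st[of k] J1[of k] by simp
  show "m 0 = 1" using gamma_law(3)[OF a, of 0] G by (simp add: mJ J_def)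
  show "m (Suc 0) = 0" using rec[of 0] w by (simp add: mJ)
  have "J 0 (Suc (Suc k)) = (k + 1) * (\<alpha> / w\<^sup>2 * J 0 k + 1 / w * J 0 (Suc k))"
    using rec[of "Suc k"] J1[of k] w by (simp add: field_simps power2_eq_square)
  then show "m (Suc (Suc k)) = (k + 1) * (\<alpha> / (\<tau> * e)\<^sup>2 * m k + 1 / (\<tau> * e) * m (Suc k))"
    using w G by (simp add: mJ w_def[symmetric] field_simps)
qed

text \<open>Serves two changes of centre: from the Gamma mean to \<open>\<tau>\<close>, and from the
  Gaussian mean to 0.\<close>

lemma integral_shift_power:
  fixes f :: "real \<Rightarrow> real"
  assumes "\<And>k. integrable M (\<lambda>x. f x ^ k)"
  shows "(LINT x|M. (f x + s) ^ k) = (\<Sum>j\<le>k. of_nat (k choose j) * ((LINT x|M. f x ^ j) * s ^ (k - j)))"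
proof -
  have "(LINT x|M. (f x + s) ^ k) = (LINT x|M. (\<Sum>j\<le>k. (of_nat (k choose j) * s ^ (k - j)) * f x ^ j))"
    by (simp add: binomial_ring mult_ac)
  then show ?thesis using assms by (simp add: mult_ac)
qed

lemma gauss_egf_nth:
  "fact k * fps_nth (gauss_egf m) k = (\<Sum>j\<le>k. of_nat (k choose j) *
     ((fact j * (if even j then 1 / (4 ^ (j div 2) * fact (j div 2)) else 0)) * m ^ (k - j)))"
  unfolding gauss_egf_def egf_mult_nth by simp

text \<open>The fluctuation about the exact mean \<open>a \<tau> + 1\<close> is separated from the
  displacement of that mean. The former gives the centred Gaussian, the latter the shift by
  \<open>m\<close>.\<close>

lemma gamma_law_tendsto:
  assumes a: "\<forall>\<^sub>F \<tau> in at_top. a \<tau> > -1"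
    and lim: "(\<lambda>\<tau>. a \<tau> + 1 - (\<tau> + sqrt (2 * \<tau>) * m)) \<in> O[at_top](\<lambda>_. 1)"
  shows "std_moments_tendsto (\<lambda>\<tau>. \<tau>) (\<lambda>\<tau>. density_measure (gamma_weight (a \<tau>))) (gauss_egf m)"
  unfolding std_moments_tendsto_def
proof (intro conjI allI)
  show "\<forall>\<^sub>F \<tau> in at_top. pos_moments (density_measure (gamma_weight (a \<tau>)))"
    using a by eventually_elim (auto intro: gamma_law)
  fix k
  \<comment> \<open>The length in \<open>x\<close> that corresponds to a unit of
    \<open>t\<close>.\<close>
  define w where "w \<tau> = \<tau> * scale_eps \<tau>" for \<tau>
  have w: "w \<tau> = sqrt (2 * \<tau>)" if "\<tau> > 0" for \<tau>
  proof -
    have "w \<tau> = sqrt (\<tau>\<^sup>2) * sqrt (2 / \<tau>)" using that by (simp add: w_def scale_eps_def)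
    also have "\<dots> = sqrt (2 * \<tau>)"
      using that by (subst real_sqrt_mult[symmetric]) (simp add: power2_eq_square)
    finally show ?thesis .
  qed
  have inv_w: "((\<lambda>\<tau>. 1 / w \<tau>) \<longlongrightarrow> 0) at_top"
  proof (rule Lim_transform_eventually)
    show "((\<lambda>\<tau>. 1 / sqrt (2 * \<tau>)) \<longlongrightarrow> 0) at_top" by real_asymp
    show "\<forall>\<^sub>F \<tau> in at_top. 1 / sqrt (2 * \<tau>) = 1 / w \<tau>"
      using eventually_gt_at_top[of 0] by eventually_elim (simp add: w)
  qed
  \<comment> \<open>The mean of the Gamma law in the coordinate \<open>t\<close>. The error allowed
    by \<open>lim\<close> is bounded, so dividing it by \<open>w \<tau> = sqrt (2 * \<tau>)\<close>
    makes it vanish.\<close>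
  define s where "s \<tau> = (a \<tau> + 1 - \<tau>) / w \<tau>" for \<tau>
  have s: "(s \<longlongrightarrow> m) at_top"
  proof (rule Lim_transform_eventually)
    have "(\<lambda>\<tau>. (a \<tau> + 1 - (\<tau> + sqrt (2 * \<tau>) * m)) * (1 / w \<tau>)) \<in> O[at_top](\<lambda>\<tau>. 1 * (1 / w \<tau>))"
      using lim by (rule landau_o.big.mult) simp
    moreover have "(\<lambda>\<tau>. 1 * (1 / w \<tau>)) \<in> o[at_top](\<lambda>_. 1)"
      using inv_w by (intro smalloI_tendsto) auto
    ultimately have "(\<lambda>\<tau>. (a \<tau> + 1 - (\<tau> + sqrt (2 * \<tau>) * m)) * (1 / w \<tau>)) \<in> o[at_top](\<lambda>_. 1)"
      by (rule landau_o.big_small_trans)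
    then have "((\<lambda>\<tau>. (a \<tau> + 1 - (\<tau> + sqrt (2 * \<tau>) * m)) * (1 / w \<tau>)) \<longlongrightarrow> 0) at_top"
      by (auto dest: smalloD_tendsto)
    from tendsto_add[OF this tendsto_const[of m]]
    show "((\<lambda>\<tau>. (a \<tau> + 1 - (\<tau> + sqrt (2 * \<tau>) * m)) * (1 / w \<tau>) + m) \<longlongrightarrow> m) at_top"
      by simp
    show "\<forall>\<^sub>F \<tau> in at_top. (a \<tau> + 1 - (\<tau> + sqrt (2 * \<tau>) * m)) * (1 / w \<tau>) + m = s \<tau>"
      using eventually_gt_at_top[of 0] by eventually_elim (simp add: s_def w field_simps)
  qed
  \<comment> \<open>The variance in the coordinate \<open>t\<close>: a Gamma law has variance equal
    to its shape, and \<open>(w \<tau>)\<^sup>2 = 2 * \<tau>\<close>.\<close>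
  have A: "((\<lambda>\<tau>. (a \<tau> + 1) / (w \<tau>)\<^sup>2) \<longlongrightarrow> 1 / 2) at_top"
  proof (rule Lim_transform_eventually)
    have "((\<lambda>\<tau>. s \<tau> * (1 / w \<tau>) + 1 / 2) \<longlongrightarrow> m * 0 + 1 / 2) at_top"
      by (intro tendsto_intros s inv_w)
    then show "((\<lambda>\<tau>. s \<tau> * (1 / w \<tau>) + 1 / 2) \<longlongrightarrow> 1 / 2) at_top" by simp
    show "\<forall>\<^sub>F \<tau> in at_top. s \<tau> * (1 / w \<tau>) + 1 / 2 = (a \<tau> + 1) / (w \<tau>)\<^sup>2"
      using eventually_gt_at_top[of 0]
    proof eventually_elim
      case (elim \<tau>)
      have "w \<tau> > 0" "(w \<tau>)\<^sup>2 = 2 * \<tau>" using elim by (auto simp: w)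
      then have "s \<tau> * (1 / w \<tau>) = (a \<tau> + 1 - \<tau>) / (2 * \<tau>)"
        by (simp add: s_def power2_eq_square)
      then show ?case
        unfolding \<open>(w \<tau>)\<^sup>2 = 2 * \<tau>\<close> \<open>s \<tau> * (1 / w \<tau>) = (a \<tau> + 1 - \<tau>) / (2 * \<tau>)\<close>
        using elim by (simp add: field_simps)
    qed
  qed
  define M where "M \<tau> j = (LINT x|density_measure (gamma_weight (a \<tau>)). ((x - (a \<tau> + 1)) / w \<tau>) ^ j) / Gamma (a \<tau> + 1)" for \<tau> j
  \<comment> \<open>The moments of the centred Gaussian with variance 1/2, namely
    \<open>(2 i)! / (4^i i!)\<close> in order \<open>2 i\<close>.\<close>
  define C where "C j = (fact j * (if even j then 1 / (4 ^ (j div 2) * fact (j div 2)) else 0) :: real)" for j :: nat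
  have rec: "\<forall>\<^sub>F \<tau> in at_top. M \<tau> 0 = 1 \<and> M \<tau> (Suc 0) = 0 \<and>
      (\<forall>j. M \<tau> (Suc (Suc j)) = (j + 1) * ((a \<tau> + 1) / (w \<tau>)\<^sup>2 * M \<tau> j + 1 / w \<tau> * M \<tau> (Suc j)))"
    using a eventually_gt_at_top[of 0]
  proof eventually_elim
    case (elim \<tau>)
    then have "scale_eps \<tau> > 0" by (simp add: scale_eps_def)
    then show ?case
      using gamma_central_recurrence[of "a \<tau> + 1" \<tau> "scale_eps \<tau>"] elim by (simp add: M_def w_def)
  qed
  have C: "C 0 = 1" "C 1 = 0" "C (Suc (Suc j)) = (real j + 1) / 2 * C j" for j
  proof -
    show "C 0 = 1" "C 1 = 0" by (simp_all add: C_def)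
    show "C (Suc (Suc j)) = (real j + 1) / 2 * C j"
    proof (cases "even j")
      case True
      then obtain i where "j = 2 * i" by (elim evenE)
      \<comment> \<open>From \<open>i\<close> to \<open>i + 1\<close> the numerator gains
        \<open>(2 i + 2) (2 i + 1)\<close> and the denominator \<open>4 (i + 1)\<close>; the common
        factor \<open>2 (i + 1)\<close> cancels.\<close>
      have double: "((2 * r + 2) * (2 * r + 1) * F) / (4 * (r + 1) * D) = (2 * r + 1) / 2 * (F / D)"
        if "D > 0" "r \<ge> 0" for r F D :: real
      proof -
        have "((2 * r + 2) * (2 * r + 1) * F) / (4 * (r + 1) * D) = ((2 * (r + 1)) * ((2 * r + 1) * F)) / ((2 * (r + 1)) * (2 * D))"
          by (simp add: algebra_simps)
        also have "\<dots> = ((2 * r + 1) * F) / (2 * D)"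
          using that by (subst mult_divide_mult_cancel_left) auto
        finally show ?thesis by simp
      qed
      have "C (Suc (Suc j)) = ((2 * real i + 2) * (2 * real i + 1) * fact (2 * i)) / (4 * (real i + 1) * (4 ^ i * fact i))"
        using \<open>j = 2 * i\<close> by (simp add: C_def mult_ac add_ac)
      also have "\<dots> = (real j + 1) / 2 * C j"
        using \<open>j = 2 * i\<close> by (subst double) (simp_all add: C_def)
      finally show ?thesis by simp
    qed (simp add: C_def)
  qed
  \<comment> \<open>Strong induction, as the recurrence reaches back two orders.\<close>
  have M: "((\<lambda>\<tau>. M \<tau> j) \<longlongrightarrow> C j) at_top" for j
  proof (induction j rule: less_induct)
    case (less j)
    consider "j = 0" | "j = Suc 0" | i where "j = Suc (Suc i)" by (metis not0_implies_Suc)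
    then show ?case
    proof cases
      case 1
      have "\<forall>\<^sub>F \<tau> in at_top. M \<tau> j = C j" using rec by eventually_elim (use 1 C in simp)
      then show ?thesis by (rule tendsto_eventually)
    next
      case 2
      have "\<forall>\<^sub>F \<tau> in at_top. M \<tau> j = C j" using rec by eventually_elim (use 2 C in simp)
      then show ?thesis by (rule tendsto_eventually)
    next
      case 3
      have "((\<lambda>\<tau>. (i + 1) * ((a \<tau> + 1) / (w \<tau>)\<^sup>2 * M \<tau> i + 1 / w \<tau> * M \<tau> (Suc i)))
          \<longlongrightarrow> (i + 1) * (1 / 2 * C i + 0 * C (Suc i))) at_top"
        using 3 by (intro tendsto_mult tendsto_add tendsto_const A inv_w less.IH) auto
      also have "(i + 1) * (1 / 2 * C i + 0 * C (Suc i)) = C j"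
        using C(3)[of i] 3 by simp
      finally show ?thesis
        by (rule Lim_transform_eventually) (use rec in eventually_elim, simp add: 3)
    qed
  qed
  have "((\<lambda>\<tau>. \<Sum>j\<le>k. of_nat (k choose j) * (M \<tau> j * s \<tau> ^ (k - j)))
     \<longlongrightarrow> (\<Sum>j\<le>k. of_nat (k choose j) * (C j * m ^ (k - j)))) at_top"
    by (intro tendsto_intros M s)
  also have "(\<Sum>j\<le>k. of_nat (k choose j) * (C j * m ^ (k - j))) = fact k * fps_nth (gauss_egf m) k"
    by (simp add: gauss_egf_nth C_def)
  finally show "((\<lambda>\<tau>. std_moment \<tau> (scale_eps \<tau>) (density_measure (gamma_weight (a \<tau>))) k)
      \<longlongrightarrow> fact k * fps_nth (gauss_egf m) k) at_top"
  proof (rule Lim_transform_eventually)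
    show "\<forall>\<^sub>F \<tau> in at_top. (\<Sum>j\<le>k. of_nat (k choose j) * (M \<tau> j * s \<tau> ^ (k - j)))
      = std_moment \<tau> (scale_eps \<tau>) (density_measure (gamma_weight (a \<tau>))) k"
      using a eventually_gt_at_top[of 0]
    proof eventually_elim
      case (elim \<tau>)
      define D where "D = density_measure (gamma_weight (a \<tau>))"
      have "scale_eps \<tau> > 0" using elim by (simp add: scale_eps_def)
      have "w \<tau> > 0" using elim by (simp add: w)
      have int: "integrable D (\<lambda>x. ((x - (a \<tau> + 1)) / w \<tau>) ^ j)" for j
      proof -
        have "integrable D (\<lambda>x. x ^ 0 * (1 / w \<tau> * x + (- (a \<tau> + 1) / w \<tau>)) ^ j)"
          unfolding D_def using gamma_law(1)[OF elim(1)]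
          by (intro integrable_affine_power) (simp add: pos_moments_def)
        moreover have "1 / w \<tau> * x + (- (a \<tau> + 1) / w \<tau>) = (x - (a \<tau> + 1)) / w \<tau>" for x
          using \<open>w \<tau> > 0\<close> by (simp add: field_simps)
        ultimately show ?thesis by simp
      qed
      have "(x / \<tau> - 1) / scale_eps \<tau> = (x - (a \<tau> + 1)) / w \<tau> + s \<tau>" for x
        using elim \<open>scale_eps \<tau> > 0\<close> by (simp add: s_def w_def field_simps)
      then show ?case
        using integral_shift_power[OF int, of "s \<tau>" k]
        by (simp add: std_moment_def gamma_law(2)[OF elim(1)] M_def D_def sum_divide_distrib)
    qed
  qed
qed

section \<open>The limit law\<close>

text \<open>The argument is written \<open>0 + \<rho> * u\<close> to match the affine substitution
  rule for Lebesgue measure.\<close>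

lemma gamma_density_eq_gamma_weight:
  assumes "\<rho> > 0" "d > 0"
  shows "gamma_density \<rho> d u = \<rho> / Gamma d * gamma_weight (d - 1) (0 + \<rho> * u)"
proof -
  have "\<rho> powr d = \<rho> * \<rho> powr (d - 1)"
    using assms by (simp add: powr_diff)
  then show ?thesis
    using assms by (simp add: gamma_density_def gamma_weight_def powr_mult zero_less_mult_iff)
qed

lemma has_bochner_integral_gamma_density:
  assumes "\<rho> > 0" "d > 0"
  shows "has_bochner_integral lborel (gamma_density \<rho> d) 1"
proof -
  have "has_bochner_integral lborel (\<lambda>u. gamma_weight (d - 1) (0 + \<rho> * u)) (Gamma d /\<^sub>R \<bar>\<rho>\<bar>)"
    using has_bochner_integral_gamma_weight[of "d - 1"] assms
    by (subst lborel_has_bochner_integral_real_affine_iff[symmetric]) auto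
  then have "has_bochner_integral lborel (\<lambda>u. \<rho> / Gamma d * gamma_weight (d - 1) (0 + \<rho> * u)) (\<rho> / Gamma d * (Gamma d /\<^sub>R \<bar>\<rho>\<bar>))"
    by (intro has_bochner_integral_mult_right)
  also have "(\<lambda>u. \<rho> / Gamma d * gamma_weight (d - 1) (0 + \<rho> * u)) = gamma_density \<rho> d"
    using gamma_density_eq_gamma_weight[OF assms] by (intro ext) simp
  also have "\<rho> / Gamma d * (Gamma d /\<^sub>R \<bar>\<rho>\<bar>) = 1"
    using assms Gamma_real_nonzero[of d] by simp
  finally show ?thesis .
qed

text \<open>The factor \<open>u ^ k\<close> raises the shape to \<open>d + k\<close> at the same
  rate; the moment is the quotient of the normalising constants.\<close>

lemma has_bochner_integral_gamma_density_moment: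
  assumes "\<rho> > 0" "d > 0"
  shows "has_bochner_integral lborel (\<lambda>u. gamma_density \<rho> d u * u ^ k) (pochhammer d k / \<rho> ^ k)"
proof -
  have "(\<lambda>u. gamma_density \<rho> d u * u ^ k) = (\<lambda>u. pochhammer d k / \<rho> ^ k * gamma_density \<rho> (d + k) u)"
  proof
    fix u
    have "Gamma (d + k) = pochhammer d k * Gamma d"
      using assms Gamma_real_nonzero[of d] by (simp add: Gamma_shift_div[symmetric])
    moreover have "pochhammer d k \<noteq> 0" using assms by (intro pochhammer_pos[THEN less_imp_neq, symmetric]) auto
    moreover have "\<rho> powr (d + k) = \<rho> powr d * \<rho> ^ k"
      using assms by (simp add: powr_add powr_realpow)
    moreover have "u powr (d + k - 1) = u powr (d - 1) * u ^ k" if "u > 0"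
      using that by (subst powr_realpow[symmetric]) (auto simp: powr_add[symmetric] algebra_simps)
    ultimately show "gamma_density \<rho> d u * u ^ k = pochhammer d k / \<rho> ^ k * gamma_density \<rho> (d + k) u"
      using assms by (simp add: gamma_density_def)
  qed
  moreover have "has_bochner_integral lborel (\<lambda>u. pochhammer d k / \<rho> ^ k * gamma_density \<rho> (d + k) u) (pochhammer d k / \<rho> ^ k * 1)"
    using assms by (intro has_bochner_integral_mult_right has_bochner_integral_gamma_density) auto
  ultimately show ?thesis by simp
qed

text \<open>The power series records the moments in exponential form and the exponential moment
  guarantees that they determine the law.\<close>

definition has_egf :: "real measure \<Rightarrow> real fps \<Rightarrow> bool" where
  "has_egf N F \<longleftrightarrow> real_distribution N \<and> (\<exists>c>0. integrable N (\<lambda>x. exp (c * \<bar>x\<bar>))) \<and>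
     (\<forall>k. (LINT x|N. x ^ k) = fact k * fps_nth F k)"

lemma has_egf_integrable_power: "has_egf N F \<Longrightarrow> integrable N (\<lambda>x. x ^ k)"
  unfolding has_egf_def by (metis integrable_power_exp_moment real_distribution.events_eq_borel)

lemma integrable_exp_abs_mono:
  assumes "sets N = sets borel" "integrable N (\<lambda>x. exp (c * \<bar>x\<bar>))" "c' \<le> (c::real)"
  shows "integrable N (\<lambda>x. exp (c' * \<bar>x\<bar>))"
proof (rule Bochner_Integration.integrable_bound[OF assms(2)])
  note [measurable_cong] = assms(1)
  show "(\<lambda>x. exp (c' * \<bar>x\<bar>)) \<in> borel_measurable N" by measurable
  show "AE x in N. norm (exp (c' * \<bar>x\<bar>)) \<le> norm (exp (c * \<bar>x\<bar>))"
    using assms(3) by (intro AE_I2) (auto intro!: mult_right_mono)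
qed

lemma real_distribution_density_measure:
  assumes "f \<in> borel_measurable borel" "\<And>x. f x \<ge> 0" "has_bochner_integral lborel f 1"
  shows "real_distribution (density_measure f)"
proof -
  interpret finite_measure "density_measure f"
    by (rule finite_measure_density_measure[OF assms])
  have "prob_space (density_measure f)"
    using finite_measure_density_measure(2)[OF assms]
    by (intro prob_spaceI) (simp add: emeasure_eq_measure)
  then show ?thesis
    by (simp add: real_distribution_def real_distribution_axioms_def)
qed

text \<open>Half the rate is given away; what is left is \<open>2 powr d\<close> times the Gamma
  density of rate \<open>\<rho> / 2\<close>.\<close>

lemma gamma_density_exp_integrable:
  assumes "\<rho> > 0" "d > 0"
  shows "integrable (density_measure (gamma_density \<rho> d)) (\<lambda>u. exp (\<rho> / 2 * \<bar>u\<bar>))"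
proof -
  have "(\<lambda>u. gamma_density \<rho> d u * exp (\<rho> / 2 * \<bar>u\<bar>)) = (\<lambda>u. 2 powr d * gamma_density (\<rho> / 2) d u)"
    using assms by (intro ext) (auto simp: gamma_density_def powr_divide mult_exp_exp field_simps)
  moreover have "integrable lborel (gamma_density (\<rho> / 2) d)"
    using has_bochner_integral_gamma_density[of "\<rho> / 2" d] assms by (simp add: has_bochner_integral_iff)
  ultimately show ?thesis
    using assms by (subst integrable_density_measure) (auto simp: gamma_density_nonneg)
qed

text \<open>Subtracting an independent Gamma variable multiplies generating functions. Measurability
  and nonnegativity belong to the conclusion so that the statement can be iterated along a list of
  operators.\<close>

lemma has_egf_K_op:
  assumes f: "f \<in> borel_measurable borel" "\<And>t. f t \<ge> 0" "has_egf (density_measure f) F"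
    and \<rho>: "\<rho> > 0" and d: "d \<ge> 0"
  shows "K_op \<rho> d f \<in> borel_measurable borel \<and> (\<forall>t. K_op \<rho> d f t \<ge> 0) \<and>
    has_egf (density_measure (K_op \<rho> d f)) (gamma_egf \<rho> d * F)"
proof (cases "d = 0")
  case True
  \<comment> \<open>For \<open>d = 0\<close> there is no Gamma law; the definition of
    \<open>K_op\<close> takes the identity, in agreement with the series being 1.\<close>
  have "gamma_egf \<rho> 0 = 1"
    by (rule fps_ext) (simp add: gamma_egf_def pochhammer_0_left)
  moreover have "K_op \<rho> 0 f = f"
    by (rule ext) (simp add: K_op_def)
  ultimately show ?thesis using f True by simp
next
  case False
  with d have d: "d > 0" by simp
  define G where "G = density_measure (gamma_density \<rho> d)"
  define N where "N = density_measure f"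
  note G = finite_measure_density_measure[OF gamma_density_measurable gamma_density_nonneg[OF d \<rho>]
      has_bochner_integral_gamma_density[OF \<rho> d]]
  have rdG: "real_distribution G" unfolding G_def
    by (intro real_distribution_density_measure has_bochner_integral_gamma_density gamma_density_nonneg d \<rho>) simp
  interpret N: real_distribution N using f(3) by (simp add: has_egf_def N_def)
  interpret G: real_distribution G by (rule rdG)
  interpret P: pair_prob_space G N ..
  have finN: "finite_measure N" and finG: "finite_measure G" by unfold_locales
  note K = density_measure_K_op[OF f(1,2) finN[unfolded N_def] \<rho> d G(1)]
  define M where "M = density_measure (K_op \<rho> d f)"
  have M: "M = distr (G \<Otimes>\<^sub>M N) borel (\<lambda>(u, y). y - u)"
    unfolding M_def K(3) G_def N_def ..
  have [measurable_cong]: "sets G = sets borel" "sets N = sets borel"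
    by (simp_all add: G_def N_def)
  have meas: "(\<lambda>(u, y). y - u) \<in> borel_measurable (G \<Otimes>\<^sub>M N)" by measurable
  have "prob_space M" unfolding M by (rule P.prob_space_distr[OF meas])
  then have rd: "real_distribution M"
    by (simp add: real_distribution_def real_distribution_axioms_def M)
  obtain c where c: "c > 0" "integrable N (\<lambda>x. exp (c * \<bar>x\<bar>))"
    using f(3) by (auto simp: has_egf_def N_def)
  \<comment> \<open>A rate admissible for both laws. By the triangle inequality
    \<open>exp (c' * \<bar>y - u\<bar>)\<close> is at most a product of a function of
    \<open>u\<close> and one of \<open>y\<close>, integrable by independence.\<close>
  define c' where "c' = min c (\<rho> / 2)"
  have c': "c' > 0" "integrable N (\<lambda>x. exp (c' * \<bar>x\<bar>))" "integrable G (\<lambda>x. exp (c' * \<bar>x\<bar>))"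
    using c \<rho> integrable_exp_abs_mono[OF _ c(2), of c']
      integrable_exp_abs_mono[OF _ gamma_density_exp_integrable[OF \<rho> d], of c']
    by (auto simp: c'_def N_def G_def)
  have "integrable (G \<Otimes>\<^sub>M N) (\<lambda>z. exp (c' * \<bar>snd z - fst z\<bar>))"
  proof (rule Bochner_Integration.integrable_bound[OF integrable_pair_mult[OF finG finN c'(3,2)]])
    show "(\<lambda>z. exp (c' * \<bar>snd z - fst z\<bar>)) \<in> borel_measurable (G \<Otimes>\<^sub>M N)" by measurable
    have "c' * \<bar>y - u\<bar> \<le> c' * \<bar>u\<bar> + c' * \<bar>y\<bar>" for u y
      using mult_left_mono[of "\<bar>y - u\<bar>" "\<bar>u\<bar> + \<bar>y\<bar>" c'] c'(1) by (simp add: distrib_left)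
    then show "AE z in G \<Otimes>\<^sub>M N. norm (exp (c' * \<bar>snd z - fst z\<bar>)) \<le> norm (exp (c' * \<bar>fst z\<bar>) * exp (c' * \<bar>snd z\<bar>))"
      by (intro AE_I2) (simp add: exp_add[symmetric])
  qed
  then have expM: "integrable M (\<lambda>x. exp (c' * \<bar>x\<bar>))"
    unfolding M using meas by (subst integrable_distr_eq) (auto simp: case_prod_beta)
  have momG: "integrable G (\<lambda>u. u ^ k)" "(LINT u|G. u ^ k) = pochhammer d k / \<rho> ^ k" for k
    using has_bochner_integral_gamma_density_moment[OF \<rho> d, of k] d \<rho>
    by (auto simp: G_def integrable_density_measure integral_density_measure gamma_density_nonneg has_bochner_integral_iff)
  have momG': "integrable G (\<lambda>u. (- u) ^ k)" "(LINT u|G. (- u) ^ k) = fact k * fps_nth (gamma_egf \<rho> d) k" for k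
  proof -
    have *: "(\<lambda>u. (- u) ^ k) = (\<lambda>u::real. (-1) ^ k * u ^ k)"
      by (rule ext) (rule power_minus)
    show "integrable G (\<lambda>u. (- u) ^ k)" "(LINT u|G. (- u) ^ k) = fact k * fps_nth (gamma_egf \<rho> d) k"
      unfolding * using momG[of k] by (simp_all add: gamma_egf_def)
  qed
  have momN: "integrable N (\<lambda>y. y ^ k)" "(LINT y|N. y ^ k) = fact k * fps_nth F k" for k
    using has_egf_integrable_power[OF f(3)] f(3) by (auto simp: N_def has_egf_def)
  have "(LINT x|M. x ^ k) = fact k * fps_nth (gamma_egf \<rho> d * F) k" for k
  proof -
    have "(LINT x|M. x ^ k) = (LINT z|(G \<Otimes>\<^sub>M N). (\<Sum>j\<le>k. of_nat (k choose j) * ((- fst z) ^ j * snd z ^ (k - j))))"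
    proof -
      have "(y - u) ^ k = (\<Sum>j\<le>k. of_nat (k choose j) * ((- u) ^ j * y ^ (k - j)))" for u y :: real
        using binomial_ring[of "- u" y k] by (simp add: mult_ac)
      then show ?thesis
        unfolding M using meas by (subst integral_distr) (auto simp: case_prod_beta)
    qed
    also have "\<dots> = (\<Sum>j\<le>k. of_nat (k choose j) * ((LINT u|G. (- u) ^ j) * (LINT y|N. y ^ (k - j))))"
      using integrable_pair_mult[OF finG finN momG'(1) momN(1)] integral_pair_mult[OF finG finN momG'(1) momN(1)]
      by (subst Bochner_Integration.integral_sum) auto
    finally show ?thesis unfolding momG'(2) momN(2) egf_mult_nth .
  qed
  then show ?thesis
    using K(1,2) rd expM c'(1) by (auto simp: has_egf_def M_def)
qed

section \<open>The Gaussian and the iterated limit profile\<close>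

lemma gauss_phi_eq_normal_density: "gauss_phi m = normal_density m (1 / sqrt 2)"
  by (rule ext) (simp add: gauss_phi_def normal_density_def power_divide real_sqrt_divide field_simps)

lemma gauss_phi_measurable [measurable]: "gauss_phi m \<in> borel_measurable borel"
  unfolding gauss_phi_def by measurable

lemma gauss_phi_nonneg: "gauss_phi m t \<ge> 0"
  by (simp add: gauss_phi_def)

lemma has_bochner_integral_gauss_phi_central_moment:
  "has_bochner_integral lborel (\<lambda>x. gauss_phi m x * (x - m) ^ k)
     (fact k * (if even k then 1 / (4 ^ (k div 2) * fact (k div 2)) else 0))"
proof (cases "even k")
  case True
  then obtain j where "k = 2 * j" by (elim evenE)
  then show ?thesis
    using normal_moment_even[of "1 / sqrt 2" m j] by (simp add: gauss_phi_eq_normal_density power_divide)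
next
  case False
  then obtain j where "k = 2 * j + 1" by (elim oddE)
  then show ?thesis
    using normal_moment_odd[of "1 / sqrt 2" m j] by (simp add: gauss_phi_eq_normal_density)
qed

lemma has_egf_gauss: "has_egf (density_measure (gauss_phi m)) (gauss_egf m)"
  unfolding has_egf_def
proof (intro conjI allI exI)
  have 1: "has_bochner_integral lborel (gauss_phi m) 1" for m
    using has_bochner_integral_gauss_phi_central_moment[of m 0] by simp
  show "real_distribution (density_measure (gauss_phi m))"
    by (intro real_distribution_density_measure 1 gauss_phi_nonneg) simp
  show "(0::real) < 1" by simp
  have "integrable lborel (\<lambda>x. gauss_phi m x * exp (1 * \<bar>x\<bar>))"
  proof (rule Bochner_Integration.integrable_bound)
    show "integrable lborel (\<lambda>x. exp (1 / 4 + m) * gauss_phi (m + 1 / 2) x + exp (1 / 4 - m) * gauss_phi (m - 1 / 2) x)"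
      using 1 by (auto simp: has_bochner_integral_iff)
    show "AE x in lborel. norm (gauss_phi m x * exp (1 * \<bar>x\<bar>)) \<le>
        norm (exp (1 / 4 + m) * gauss_phi (m + 1 / 2) x + exp (1 / 4 - m) * gauss_phi (m - 1 / 2) x)"
    proof (intro AE_I2)
      fix x :: real
      \<comment> \<open>Completing the square: tilting by \<open>exp (s * x)\<close> moves the mean
        by \<open>s / 2\<close>, the variance times \<open>s\<close>. With \<open>s = 1\<close> and
        \<open>s = - 1\<close> the two tilts dominate \<open>exp \<bar>x\<bar>\<close>.\<close>
      have shift: "gauss_phi m x * exp (s * x) = exp (s\<^sup>2 / 4 + s * m) * gauss_phi (m + s / 2) x" for s
      proof -
        have "- (x - m)\<^sup>2 + s * x = (s\<^sup>2 / 4 + s * m) + - (x - (m + s / 2))\<^sup>2"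
          by (simp add: power2_eq_square field_simps)
        then show ?thesis by (simp add: gauss_phi_def mult_exp_exp)
      qed
      have "gauss_phi m x * exp (1 * \<bar>x\<bar>) \<le> gauss_phi m x * exp (1 * x) + gauss_phi m x * exp ((-1) * x)"
        using gauss_phi_nonneg[of m x] by (auto simp: abs_if)
      also have "\<dots> = exp (1 / 4 + m) * gauss_phi (m + 1 / 2) x + exp (1 / 4 - m) * gauss_phi (m - 1 / 2) x"
        unfolding shift by simp
      finally show "norm (gauss_phi m x * exp (1 * \<bar>x\<bar>)) \<le>
        norm (exp (1 / 4 + m) * gauss_phi (m + 1 / 2) x + exp (1 / 4 - m) * gauss_phi (m - 1 / 2) x)"
        using gauss_phi_nonneg[of m x] by simp
    qed
  qed measurable
  then show "integrable (density_measure (gauss_phi m)) (\<lambda>x. exp (1 * \<bar>x\<bar>))"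
    by (subst integrable_density_measure) (auto simp: gauss_phi_nonneg)
  fix k
  have int: "integrable (density_measure (gauss_phi m)) (\<lambda>x. (x - m) ^ k)"
    "(LINT x|density_measure (gauss_phi m). (x - m) ^ k) = fact k * (if even k then 1 / (4 ^ (k div 2) * fact (k div 2)) else 0)" for k
    using has_bochner_integral_gauss_phi_central_moment[of m k]
    by (auto simp: integrable_density_measure integral_density_measure gauss_phi_nonneg has_bochner_integral_iff)
  show "(LINT x|density_measure (gauss_phi m). x ^ k) = fact k * fps_nth (gauss_egf m) k"
    using integral_shift_power[OF int(1), of m k] unfolding int(2) gauss_egf_nth by simp
qed

lemma has_egf_limit_profile:
  fixes \<rho> d :: "nat \<Rightarrow> real" and m :: real
  assumes "\<And>h. h \<in> set hs \<Longrightarrow> \<rho> h > 0" "\<And>h. h \<in> set hs \<Longrightarrow> d h \<ge> 0"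
  defines "f \<equiv> foldr (\<lambda>h. K_op (\<rho> h) (d h)) hs (gauss_phi m)"
  shows "f \<in> borel_measurable borel \<and> (\<forall>t. f t \<ge> 0) \<and>
    has_egf (density_measure f) (prod_list (map (\<lambda>h. gamma_egf (\<rho> h) (d h)) hs) * gauss_egf m)"
  unfolding f_def using assms(1,2)
proof (induction hs)
  case Nil
  show ?case using has_egf_gauss by (simp add: gauss_phi_nonneg)
next
  case (Cons h hs)
  let ?f = "foldr (\<lambda>h. K_op (\<rho> h) (d h)) hs (gauss_phi m)"
  have IH: "?f \<in> borel_measurable borel" "\<And>t. ?f t \<ge> 0"
    "has_egf (density_measure ?f) (prod_list (map (\<lambda>h. gamma_egf (\<rho> h) (d h)) hs) * gauss_egf m)"
    using Cons by auto
  show ?case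
    using has_egf_K_op[OF IH, of "\<rho> h" "d h"] Cons.prems by (simp add: mult.assoc)
qed

section \<open>Laguerre weights\<close>

text \<open>An arbitrary index list and a separate Gamma parameter \<open>\<alpha>\<close> allow
  induction over the Beta factors, during which the Gamma index \<open>r + 1\<close> must not
  move.\<close>

definition weight_list :: "(nat \<Rightarrow> real) \<Rightarrow> (nat \<Rightarrow> real) \<Rightarrow> real \<Rightarrow> nat list \<Rightarrow> real \<Rightarrow> real" where
  "weight_list a b \<alpha> hs = foldr (\<lambda>h. mellin_conv (beta_weight (a h) (b h))) hs (gamma_weight \<alpha>)"

lemma weight_list_simps:
  "weight_list a b \<alpha> [] = gamma_weight \<alpha>"
  "weight_list a b \<alpha> (h # hs) = mellin_conv (beta_weight (a h) (b h)) (weight_list a b \<alpha> hs)"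
  by (simp_all add: weight_list_def)

text \<open>Reconciles \<open>density_measure\<close>, which lives on the whole line, with the
  integration over positive \<open>x\<close> in \<open>laguerre_mass\<close> and with the cutoff in
  \<open>rescaled_density\<close>.\<close>

lemma weight_list_nonpos: "x \<le> 0 \<Longrightarrow> weight_list a b \<alpha> hs x = 0"
proof (induction hs arbitrary: x)
  case Nil
  then show ?case by (simp add: weight_list_simps gamma_weight_def)
next
  case (Cons h hs)
  have *: "indicator {0<..} u *\<^sub>R (beta_weight (a h) (b h) u * weight_list a b \<alpha> hs (x / u) / u) = 0" for u
    using Cons by (auto simp: divide_nonpos_pos split: split_indicator)
  show ?case
    unfolding weight_list_simps mellin_conv_def set_lebesgue_integral_def * by simp
qed

text \<open>Each convolution needs finite mass and nonnegativity of the previous weight, so all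
  properties are proved in one induction. Masses multiply because the law is the image of a product
  measure.\<close>

lemma weight_list_law:
  assumes "\<alpha> > -1" "\<And>h. h \<in> set hs \<Longrightarrow> a h > -1 \<and> b h > a h"
  defines "D \<equiv> \<lambda>hs. density_measure (weight_list a b \<alpha> hs)"
  shows "weight_list a b \<alpha> hs \<in> borel_measurable borel \<and> (\<forall>x. weight_list a b \<alpha> hs x \<ge> 0) \<and>
    pos_moments (D hs) \<and>
    measure (D hs) UNIV = (\<Prod>h\<leftarrow>hs. Gamma (a h + 1) / Gamma (b h + 1)) * Gamma (\<alpha> + 1) \<and>
    (\<forall>h hs'. hs = h # hs' \<longrightarrow>
       D hs = distr (density_measure (beta_weight (a h) (b h)) \<Otimes>\<^sub>M D hs') borel (\<lambda>(u, y). u * y))"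
  using assms(2)
proof (induction hs)
  case Nil
  then show ?case using gamma_law[OF assms(1)] by (simp add: D_def weight_list_simps gamma_weight_nonneg)
next
  case (Cons h hs)
  then have ab: "a h > -1" "b h > a h"
    and IH: "weight_list a b \<alpha> hs \<in> borel_measurable borel" "\<And>x. weight_list a b \<alpha> hs x \<ge> 0"
      "pos_moments (D hs)"
      "measure (D hs) UNIV = (\<Prod>h\<leftarrow>hs. Gamma (a h + 1) / Gamma (b h + 1)) * Gamma (\<alpha> + 1)"
    by auto
  note B = beta_law(1,2)[OF ab]
  have fin: "finite_measure (density_measure (beta_weight (a h) (b h)))" "finite_measure (D hs)"
    using B(1) IH(3) by (auto simp: pos_moments_def)
  have zero: "beta_weight (a h) (b h) u = 0" if "u \<le> 0" for u
    using that by (simp add: beta_weight_def)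
  have D: "D hs = density_measure (weight_list a b \<alpha> hs)" for hs
    by (simp add: D_def)
  have M: "weight_list a b \<alpha> (h # hs) \<in> borel_measurable borel" "\<And>x. weight_list a b \<alpha> (h # hs) x \<ge> 0"
    "D (h # hs) = distr (density_measure (beta_weight (a h) (b h)) \<Otimes>\<^sub>M D hs) borel (\<lambda>(u, y). u * y)"
    using density_measure_mellin_conv[OF beta_weight_measurable IH(1) beta_weight_nonneg[OF ab(2)] zero IH(2) fin[unfolded D]]
    by (auto simp: weight_list_simps D)
  note P = product_pos_moments(1,2)[OF B(1) IH(3) M(3)]
  show ?case
    using M P B(2) IH(4) by (simp add: mult.assoc)
qed

lemma weight_list_tendsto:
  fixes a b :: "real \<Rightarrow> nat \<Rightarrow> real" and \<alpha> :: "real \<Rightarrow> real"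
  assumes ab: "\<And>h. h \<in> set hs \<Longrightarrow> \<forall>\<^sub>F \<tau> in at_top. a \<tau> h > -1 \<and> b \<tau> h > a \<tau> h"
    and \<alpha>: "\<forall>\<^sub>F \<tau> in at_top. \<alpha> \<tau> > -1"
    and \<alpha>_lim: "(\<lambda>\<tau>. \<alpha> \<tau> + 1 - (\<tau> + sqrt (2 * \<tau>) * m)) \<in> O[at_top](\<lambda>_. 1)"
    and \<rho>: "\<And>h. h \<in> set hs \<Longrightarrow> \<rho> h > 0"
    and a_lim: "\<And>h. h \<in> set hs \<Longrightarrow> ((\<lambda>\<tau>. scale_eps \<tau> * (a \<tau> h + 1)) \<longlongrightarrow> \<rho> h) at_top"
    and b_lim: "\<And>h. h \<in> set hs \<Longrightarrow> ((\<lambda>\<tau>. b \<tau> h - a \<tau> h) \<longlongrightarrow> d h) at_top"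
  shows "std_moments_tendsto (\<lambda>\<tau>. \<tau>) (\<lambda>\<tau>. density_measure (weight_list (a \<tau>) (b \<tau>) (\<alpha> \<tau>) hs))
     (prod_list (map (\<lambda>h. gamma_egf (\<rho> h) (d h)) hs) * gauss_egf m)"
  using ab \<rho> a_lim b_lim
proof (induction hs)
  case Nil
  then show ?case using gamma_law_tendsto[OF \<alpha> \<alpha>_lim] by (simp add: weight_list_simps)
next
  case (Cons h hs)
  \<comment> \<open>The list is finite, so one threshold in \<open>\<tau>\<close> serves all its
    indices.\<close>
  have "\<forall>\<^sub>F \<tau> in at_top. \<forall>h\<in>set (h # hs). a \<tau> h > -1 \<and> b \<tau> h > a \<tau> h"
    by (intro eventually_ball_finite ballI Cons.prems(1)) auto
  then have ev: "\<forall>\<^sub>F \<tau> in at_top. density_measure (weight_list (a \<tau>) (b \<tau>) (\<alpha> \<tau>) (h # hs)) =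
      distr (density_measure (beta_weight (a \<tau> h) (b \<tau> h)) \<Otimes>\<^sub>M density_measure (weight_list (a \<tau>) (b \<tau>) (\<alpha> \<tau>) hs))
        borel (\<lambda>(u, y). u * y)"
    using \<alpha>
  proof eventually_elim
    case (elim \<tau>)
    then show ?case using weight_list_law[of "\<alpha> \<tau>" "h # hs" "a \<tau>" "b \<tau>"] by blast
  qed
  have "std_moments_tendsto (\<lambda>\<tau>. \<tau>) (\<lambda>\<tau>. density_measure (weight_list (a \<tau>) (b \<tau>) (\<alpha> \<tau>) (h # hs)))
      (gamma_egf (\<rho> h) (d h) * (prod_list (map (\<lambda>h. gamma_egf (\<rho> h) (d h)) hs) * gauss_egf m))"
  proof (rule std_moments_tendsto_product[OF _ _ ev])
    show "std_moments_tendsto (\<lambda>_. 1) (\<lambda>\<tau>. density_measure (beta_weight (a \<tau> h) (b \<tau> h))) (gamma_egf (\<rho> h) (d h))"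
      using Cons.prems by (intro beta_law_tendsto) auto
    show "std_moments_tendsto (\<lambda>\<tau>. \<tau>) (\<lambda>\<tau>. density_measure (weight_list (a \<tau>) (b \<tau>) (\<alpha> \<tau>) hs))
        (prod_list (map (\<lambda>h. gamma_egf (\<rho> h) (d h)) hs) * gauss_egf m)"
      using Cons.prems by (intro Cons.IH) auto
    show "\<forall>\<^sub>F \<tau> in at_top. \<tau> \<noteq> (0::real)" using eventually_gt_at_top[of 0] by eventually_elim simp
  qed
  then show ?case by (simp add: mult.assoc)
qed

text \<open>Change of variables \<open>x = \<tau> + \<tau> * e * t\<close>: its Jacobian
  \<open>\<tau> * e\<close> is the prefactor of the rescaled density, and division by
  \<open>Z\<close> normalises.\<close>

lemma rescaled_density_law:
  assumes w: "w \<in> borel_measurable borel" "\<And>x. w x \<ge> 0" "\<And>x. x \<le> 0 \<Longrightarrow> w x = 0"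
    and pos: "pos_moments (density_measure w)" and \<tau>: "\<tau> > 0"
    and Z: "Z = measure (density_measure w) UNIV"
  defines "N \<equiv> density_measure (rescaled_density \<tau> Z w)"
  shows "real_distribution N" "integrable N (\<lambda>t. t ^ k)"
    "(LINT t|N. t ^ k) = std_moment \<tau> (scale_eps \<tau>) (density_measure w) k"
proof -
  define e where "e = scale_eps \<tau>"
  have e: "e > 0" using \<tau> by (simp add: e_def scale_eps_def)
  have Z0: "Z > 0" using pos Z by (simp add: pos_moments_def)
  define f where "f = rescaled_density \<tau> Z w"
  have f: "f = (\<lambda>t. \<tau> * e / Z * w (\<tau> + (\<tau> * e) * t))"
  proof
    fix t
    \<comment> \<open>The cutoff \<open>t = - 1 / e\<close> is the point \<open>x = 0\<close>, below
      which \<open>w\<close> vanishes anyway; the density is therefore a plain affine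
      substitution.\<close>
    have "w (\<tau> + (\<tau> * e) * t) = 0" if "\<not> - 1 / e < t"
    proof (rule w(3))
      have "e * t \<le> -1" using that e by (simp add: field_simps)
      then have "\<tau> * (e * t) \<le> \<tau> * (-1)" using \<tau> by (intro mult_left_mono) auto
      then show "\<tau> + (\<tau> * e) * t \<le> 0" by simp
    qed
    then show "f t = \<tau> * e / Z * w (\<tau> + (\<tau> * e) * t)"
      by (simp add: f_def rescaled_density_def scaled_point_def scale_c_def e_def[symmetric] algebra_simps)
  qed
  have [measurable]: "w \<in> borel_measurable borel" by fact
  have f_meas [measurable]: "f \<in> borel_measurable borel" unfolding f by measurable
  have f0: "f t \<ge> 0" for t unfolding f using w(2) Z0 \<tau> e by simp
  have mom: "has_bochner_integral lborel (\<lambda>t. f t * t ^ k) (std_moment \<tau> e (density_measure w) k)" for k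
  proof -
    have "integrable (density_measure w) (\<lambda>x. ((x / \<tau> - 1) / e) ^ k)"
      by (rule integrable_std_power[OF pos])
    then have "has_bochner_integral lborel (\<lambda>x. w x * ((x / \<tau> - 1) / e) ^ k) (std_moment \<tau> e (density_measure w) k * Z)"
      using Z0 w by (simp add: has_bochner_integral_iff integrable_density_measure integral_density_measure std_moment_def Z)
    then have "has_bochner_integral lborel (\<lambda>t. w (\<tau> + (\<tau> * e) * t) * (((\<tau> + (\<tau> * e) * t) / \<tau> - 1) / e) ^ k)
        ((std_moment \<tau> e (density_measure w) k * Z) /\<^sub>R \<bar>\<tau> * e\<bar>)"
      using \<tau> e by (subst lborel_has_bochner_integral_real_affine_iff[symmetric]) auto
    then have "has_bochner_integral lborel (\<lambda>t. \<tau> * e / Z * (w (\<tau> + (\<tau> * e) * t) * (((\<tau> + (\<tau> * e) * t) / \<tau> - 1) / e) ^ k))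
        (\<tau> * e / Z * ((std_moment \<tau> e (density_measure w) k * Z) /\<^sub>R \<bar>\<tau> * e\<bar>))"
      by (intro has_bochner_integral_mult_right)
    also have "(\<lambda>t. \<tau> * e / Z * (w (\<tau> + (\<tau> * e) * t) * (((\<tau> + (\<tau> * e) * t) / \<tau> - 1) / e) ^ k)) = (\<lambda>t. f t * t ^ k)"
    proof
      fix t
      have "((\<tau> + (\<tau> * e) * t) / \<tau> - 1) / e = t" using \<tau> e by (simp add: field_simps)
      then show "\<tau> * e / Z * (w (\<tau> + (\<tau> * e) * t) * (((\<tau> + (\<tau> * e) * t) / \<tau> - 1) / e) ^ k) = f t * t ^ k"
        by (simp add: f)
    qed
    also have "\<tau> * e / Z * ((std_moment \<tau> e (density_measure w) k * Z) /\<^sub>R \<bar>\<tau> * e\<bar>) = std_moment \<tau> e (density_measure w) k"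
      using \<tau> e Z0 by (simp add: abs_mult field_simps)
    finally show ?thesis .
  qed
  have "std_moment \<tau> e (density_measure w) 0 = 1"
    using pos Z0 Z by (simp add: std_moment_def)
  with mom[of 0] have one: "has_bochner_integral lborel f 1" by simp
  show "real_distribution N"
    unfolding N_def f_def[symmetric] by (rule real_distribution_density_measure[OF f_meas f0 one])
  show "integrable N (\<lambda>t. t ^ k)" "(LINT t|N. t ^ k) = std_moment \<tau> (scale_eps \<tau>) (density_measure w) k"
    using mom[of k] unfolding N_def f_def[symmetric]
    by (simp_all add: integrable_density_measure integral_density_measure f0 has_bochner_integral_iff e_def)
qed

section \<open>Masses of the Laguerre weights and the limit theorem\<close>

lemma laguerre_weight0_eq: "laguerre_weight0 r a b = weight_list a b (a (r + 1)) [1..<r+1]"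
  by (simp add: laguerre_weight0_def weight_list_def)

lemma laguerre_mass_eq:
  assumes "a (r + 1) > -1" "\<And>h. h \<in> {1..r} \<Longrightarrow> a h > -1 \<and> b h > a h"
  shows "laguerre_mass r a b = measure (density_measure (laguerre_weight0 r a b)) UNIV"
    "laguerre_mass r a b = (\<Prod>h\<in>{1..r}. Gamma (a h + 1) / Gamma (b h + 1)) * Gamma (a (r + 1) + 1)"
proof -
  note L = weight_list_law[OF assms(1), of "[1..<r+1]" a b, folded laguerre_weight0_eq]
  have ab: "a h > -1 \<and> b h > a h" if "h \<in> set [1..<r+1]" for h
    using assms(2) that by auto
  have w: "laguerre_weight0 r a b \<in> borel_measurable borel" "\<And>x. laguerre_weight0 r a b x \<ge> 0"
    "pos_moments (density_measure (laguerre_weight0 r a b))"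
    "measure (density_measure (laguerre_weight0 r a b)) UNIV =
      (\<Prod>h\<leftarrow>[1..<r+1]. Gamma (a h + 1) / Gamma (b h + 1)) * Gamma (a (r + 1) + 1)"
    using L ab by blast+
  interpret finite_measure "density_measure (laguerre_weight0 r a b)"
    using w(3) by (simp add: pos_moments_def)
  have "laguerre_mass r a b = (LBINT x. laguerre_weight0 r a b x * 1)"
    unfolding laguerre_mass_def set_lebesgue_integral_def
    by (intro Bochner_Integration.integral_cong refl)
      (auto simp: laguerre_weight0_eq weight_list_nonpos split: split_indicator)
  also have "\<dots> = (LINT x|density_measure (laguerre_weight0 r a b). 1)"
    using w by (subst integral_density_measure) auto
  finally show 1: "laguerre_mass r a b = measure (density_measure (laguerre_weight0 r a b)) UNIV" by simp
  show "laguerre_mass r a b = (\<Prod>h\<in>{1..r}. Gamma (a h + 1) / Gamma (b h + 1)) * Gamma (a (r + 1) + 1)"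
    unfolding 1 w(4) by (simp add: prod.distinct_set_conv_list[symmetric] atLeastLessThanSuc_atLeastAtMost del: upt_Suc)
qed

text \<open>Only the factor with index \<open>h\<close> changes, by the functional equation of Gamma
  at \<open>b h + 1\<close>. So \<open>Z / (b h + 1)\<close> is the true mass of the shifted weight,
  and the shifted case is an instance of the unshifted one.\<close>

lemma laguerre_mass_shift:
  assumes "a (r + 1) > -1" "\<And>h. h \<in> {1..r} \<Longrightarrow> a h > -1 \<and> b h > a h" and h: "h \<in> {1..r}"
  shows "laguerre_mass r a (b(h := b h + 1)) = laguerre_mass r a b / (b h + 1)"
proof -
  have b: "b h + 1 > 0" using assms(2)[OF h] by auto
  have G: "Gamma (b h + 1 + 1) = (b h + 1) * Gamma (b h + 1)"
    using b by (intro Gamma_plus1) (auto elim!: nonpos_Ints_cases)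
  have 1: "laguerre_mass r a (b(h := b h + 1)) =
     (\<Prod>i\<in>{1..r}. Gamma (a i + 1) / Gamma ((b(h := b h + 1)) i + 1)) * Gamma (a (r + 1) + 1)"
  proof (rule laguerre_mass_eq(2)[where a = a and r = r and b = "b(h := b h + 1)", OF assms(1)])
    fix i assume "i \<in> {1..r}"
    from assms(2)[OF this] show "a i > -1 \<and> (b(h := b h + 1)) i > a i" by auto
  qed
  have "(\<Prod>i\<in>{1..r}. Gamma (a i + 1) / Gamma ((b(h := b h + 1)) i + 1))
    = (Gamma (a h + 1) / Gamma (b h + 1 + 1)) * (\<Prod>i\<in>{1..r} - {h}. Gamma (a i + 1) / Gamma (b i + 1))"
    using h by (subst prod.remove[of _ h]) auto
  moreover have "(\<Prod>i\<in>{1..r}. Gamma (a i + 1) / Gamma (b i + 1))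
    = (Gamma (a h + 1) / Gamma (b h + 1)) * (\<Prod>i\<in>{1..r} - {h}. Gamma (a i + 1) / Gamma (b i + 1))"
    using h by (subst prod.remove[of _ h]) auto
  moreover have "laguerre_mass r a b = (\<Prod>i\<in>{1..r}. Gamma (a i + 1) / Gamma (b i + 1)) * Gamma (a (r + 1) + 1)"
    by (intro laguerre_mass_eq(2) assms(1,2))
  ultimately show ?thesis
    unfolding 1 G by simp
qed

text \<open>The limit enters only through its generating function and \<open>Z\<close> only up to
  eventual equality, so that the same statement applies to the limit \<open>F\<close> and, with
  altered \<open>b\<close> and \<open>d\<close>, to its image under K.\<close>

lemma laguerre_weight_limit:
  fixes a b :: "real \<Rightarrow> nat \<Rightarrow> real"
  assumes a_gt: "\<forall>\<^sub>F \<tau> in at_top. \<forall>\<nu>\<in>{1..r+1}. a \<tau> \<nu> > -1"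
    and b_gt: "\<forall>\<^sub>F \<tau> in at_top. \<forall>h\<in>{1..r}. b \<tau> h > a \<tau> h"
    and a_q: "(\<lambda>\<tau>. a \<tau> (r+1) + 1 - (\<tau> + sqrt (2 * \<tau>) * ahat)) \<in> O[at_top](\<lambda>_. 1)"
    and rho_pos: "\<And>h. h \<in> {1..r} \<Longrightarrow> \<rho> h > 0"
    and a_lim: "\<And>h. h \<in> {1..r} \<Longrightarrow> ((\<lambda>\<tau>. scale_eps \<tau> * (a \<tau> h + 1)) \<longlongrightarrow> \<rho> h) at_top"
    and b_lim: "\<And>h. h \<in> {1..r} \<Longrightarrow> ((\<lambda>\<tau>. b \<tau> h - a \<tau> h) \<longlongrightarrow> d h) at_top"
    and N: "has_egf N ((\<Prod>h\<in>{1..r}. gamma_egf (\<rho> h) (d h)) * gauss_egf ahat)"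
    and Z: "\<forall>\<^sub>F \<tau> in at_top. Z \<tau> = laguerre_mass r (a \<tau>) (b \<tau>)"
  defines "M \<equiv> \<lambda>\<tau>. density_measure (rescaled_density \<tau> (Z \<tau>) (laguerre_weight0 r (a \<tau>) (b \<tau>)))"
  shows "weakly_converges M N at_top \<and> moments_converge M N at_top"
proof -
  have prod_eq: "prod_list (map (\<lambda>h. gamma_egf (\<rho> h) (d h)) [1..<r+1]) = (\<Prod>h\<in>{1..r}. gamma_egf (\<rho> h) (d h))"
    by (simp add: prod.distinct_set_conv_list[symmetric] atLeastLessThanSuc_atLeastAtMost del: upt_Suc)
  have ab: "\<forall>\<^sub>F \<tau> in at_top. a \<tau> (r + 1) > -1 \<and> (\<forall>h\<in>{1..r}. a \<tau> h > -1 \<and> b \<tau> h > a \<tau> h)"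
    using a_gt b_gt by eventually_elim auto
  have conv: "std_moments_tendsto (\<lambda>\<tau>. \<tau>) (\<lambda>\<tau>. density_measure (laguerre_weight0 r (a \<tau>) (b \<tau>)))
     ((\<Prod>h\<in>{1..r}. gamma_egf (\<rho> h) (d h)) * gauss_egf ahat)"
    unfolding laguerre_weight0_eq prod_eq[symmetric]
  proof (rule weight_list_tendsto)
    show "\<forall>\<^sub>F \<tau> in at_top. a \<tau> h > -1 \<and> b \<tau> h > a \<tau> h" if "h \<in> set [1..<r+1]" for h
      using ab by eventually_elim (use that in auto)
    show "\<forall>\<^sub>F \<tau> in at_top. a \<tau> (r + 1) > -1"
      using ab by eventually_elim auto
  qed (use a_q rho_pos a_lim b_lim in auto)
  have law: "\<forall>\<^sub>F \<tau> in at_top. real_distribution (M \<tau>) \<and> (\<forall>k. integrable (M \<tau>) (\<lambda>x. x ^ k)) \<and>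
     (\<forall>k. (LINT x|M \<tau>. x ^ k) = std_moment \<tau> (scale_eps \<tau>) (density_measure (laguerre_weight0 r (a \<tau>) (b \<tau>))) k)"
    using ab Z eventually_gt_at_top[of 0]
  proof eventually_elim
    case (elim \<tau>)
    have "a \<tau> (r + 1) > -1" "\<And>h. h \<in> set [1..<r+1] \<Longrightarrow> a \<tau> h > -1 \<and> b \<tau> h > a \<tau> h"
      using elim(1) by auto
    note L = weight_list_law[of "a \<tau> (r + 1)" "[1..<r+1]" "a \<tau>" "b \<tau>", OF this, folded laguerre_weight0_eq]
    have w: "laguerre_weight0 r (a \<tau>) (b \<tau>) \<in> borel_measurable borel"
      "\<And>x. laguerre_weight0 r (a \<tau>) (b \<tau>) x \<ge> 0"
      "pos_moments (density_measure (laguerre_weight0 r (a \<tau>) (b \<tau>)))"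
      using L by blast+
    have "Z \<tau> = measure (density_measure (laguerre_weight0 r (a \<tau>) (b \<tau>))) UNIV"
      using elim(1) unfolding elim(2) by (intro laguerre_mass_eq(1)) auto
    moreover have "laguerre_weight0 r (a \<tau>) (b \<tau>) x = 0" if "x \<le> 0" for x
      using that unfolding laguerre_weight0_eq by (rule weight_list_nonpos)
    ultimately show ?case
      unfolding M_def using w elim(3) by (intro conjI allI rescaled_density_law)
  qed
  obtain c where c: "c > 0" "integrable N (\<lambda>x. exp (c * \<bar>x\<bar>))" and rd: "real_distribution N"
    and mom: "\<And>k. (LINT x|N. x ^ k) = fact k * fps_nth ((\<Prod>h\<in>{1..r}. gamma_egf (\<rho> h) (d h)) * gauss_egf ahat) k"
    using N by (auto simp: has_egf_def)
  show ?thesis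
  proof (rule weakly_and_moments_converge[OF _ rd c(2,1)])
    show "\<forall>\<^sub>F \<tau> in at_top. real_distribution (M \<tau>) \<and> (\<forall>k. integrable (M \<tau>) (\<lambda>x. x ^ k))"
      using law by eventually_elim auto
    fix k
    have "((\<lambda>\<tau>. std_moment \<tau> (scale_eps \<tau>) (density_measure (laguerre_weight0 r (a \<tau>) (b \<tau>))) k)
        \<longlongrightarrow> (LINT x|N. x ^ k)) at_top"
      using conv unfolding mom std_moments_tendsto_def by blast
    then show "((\<lambda>\<tau>. LINT x|M \<tau>. x ^ k) \<longlongrightarrow> (LINT x|N. x ^ k)) at_top"
      by (rule Lim_transform_eventually) (use law in eventually_elim, simp)
  qed
qed

theorem theorem5p3:
  fixes r :: nat
    and a b :: "real \<Rightarrow> nat \<Rightarrow> real"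
    and \<rho> d :: "nat \<Rightarrow> real"
    and ahat :: real
  assumes a_gt: "\<forall>\<^sub>F \<tau> in at_top. \<forall>\<nu>\<in>{1..r+1}. a \<tau> \<nu> > -1"
    and b_gt: "\<forall>\<^sub>F \<tau> in at_top. \<forall>h\<in>{1..r}. b \<tau> h > a \<tau> h"
    and a_q: "(\<lambda>\<tau>. a \<tau> (r+1) + 1 - (\<tau> + sqrt (2 * \<tau>) * ahat)) \<in> O[at_top](\<lambda>_. 1)"
    and rho_pos: "\<And>h. h \<in> {1..r} \<Longrightarrow> \<rho> h > 0"
    and a_lim: "\<And>h. h \<in> {1..r} \<Longrightarrow> ((\<lambda>\<tau>. scale_eps \<tau> * (a \<tau> h + 1)) \<longlongrightarrow> \<rho> h) at_top"
    and d_nonneg: "\<And>h. h \<in> {1..r} \<Longrightarrow> d h \<ge> 0"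
    and b_lim: "\<And>h. h \<in> {1..r} \<Longrightarrow> ((\<lambda>\<tau>. b \<tau> h - a \<tau> h) \<longlongrightarrow> d h) at_top"
  shows "let Z = (\<lambda>\<tau>. laguerre_mass r (a \<tau>) (b \<tau>));
             F = limit_profile r \<rho> d ahat;
             M0 = (\<lambda>\<tau>. density_measure
                     (rescaled_density \<tau> (Z \<tau>) (laguerre_weight0 r (a \<tau>) (b \<tau>))));
             M = (\<lambda>h \<tau>. density_measure
                     (rescaled_density \<tau> (Z \<tau> / (b \<tau> h + 1)) (laguerre_weight h r (a \<tau>) (b \<tau>))))
         in (\<forall>h\<in>{1..r}.
               weakly_converges (M h) (density_measure (K_op (\<rho> h) 1 F)) at_top \<and>
               moments_converge (M h) (density_measure (K_op (\<rho> h) 1 F)) at_top) \<and>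
            weakly_converges M0 (density_measure F) at_top \<and>
            moments_converge M0 (density_measure F) at_top"
proof -
  define F where "F = limit_profile r \<rho> d ahat"
  have "F \<in> borel_measurable borel \<and> (\<forall>t. F t \<ge> 0) \<and>
    has_egf (density_measure F) (prod_list (map (\<lambda>h. gamma_egf (\<rho> h) (d h)) [1..<r+1]) * gauss_egf ahat)"
    unfolding F_def limit_profile_def using rho_pos d_nonneg by (intro has_egf_limit_profile) auto
  also have "prod_list (map (\<lambda>h. gamma_egf (\<rho> h) (d h)) [1..<r+1]) = (\<Prod>h\<in>{1..r}. gamma_egf (\<rho> h) (d h))"
    by (simp add: prod.distinct_set_conv_list[symmetric] atLeastLessThanSuc_atLeastAtMost del: upt_Suc)
  finally have F: "F \<in> borel_measurable borel" "\<And>t. F t \<ge> 0"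
    "has_egf (density_measure F) ((\<Prod>h\<in>{1..r}. gamma_egf (\<rho> h) (d h)) * gauss_egf ahat)"
    by auto
  have main: "weakly_converges (\<lambda>\<tau>. density_measure (rescaled_density \<tau> (laguerre_mass r (a \<tau>) (b \<tau>)) (laguerre_weight0 r (a \<tau>) (b \<tau>))))
      (density_measure F) at_top \<and>
    moments_converge (\<lambda>\<tau>. density_measure (rescaled_density \<tau> (laguerre_mass r (a \<tau>) (b \<tau>)) (laguerre_weight0 r (a \<tau>) (b \<tau>))))
      (density_measure F) at_top"
    by (rule laguerre_weight_limit[OF a_gt b_gt a_q rho_pos a_lim b_lim F(3)]) simp_all
  have shifted: "weakly_converges (\<lambda>\<tau>. density_measure
        (rescaled_density \<tau> (laguerre_mass r (a \<tau>) (b \<tau>) / (b \<tau> h + 1)) (laguerre_weight h r (a \<tau>) (b \<tau>))))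
      (density_measure (K_op (\<rho> h) 1 F)) at_top \<and>
    moments_converge (\<lambda>\<tau>. density_measure
        (rescaled_density \<tau> (laguerre_mass r (a \<tau>) (b \<tau>) / (b \<tau> h + 1)) (laguerre_weight h r (a \<tau>) (b \<tau>))))
      (density_measure (K_op (\<rho> h) 1 F)) at_top" if h: "h \<in> {1..r}" for h
    unfolding laguerre_weight_def
  proof (rule laguerre_weight_limit[OF a_gt _ a_q rho_pos a_lim, where d = "d(h := d h + 1)"])
    show "\<forall>\<^sub>F \<tau> in at_top. \<forall>i\<in>{1..r}. ((b \<tau>)(h := b \<tau> h + 1)) i > a \<tau> i"
      using b_gt
    proof eventually_elim
      case (elim \<tau>)
      show ?case
      proof
        fix i assume "i \<in> {1..r}"
        then have "a \<tau> i < b \<tau> i" using elim by blast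
        then show "((b \<tau>)(h := b \<tau> h + 1)) i > a \<tau> i" by auto
      qed
    qed
    show "((\<lambda>\<tau>. ((b \<tau>)(h := b \<tau> h + 1)) i - a \<tau> i) \<longlongrightarrow> (d(h := d h + 1)) i) at_top" if "i \<in> {1..r}" for i
      using tendsto_add[OF b_lim[OF that] tendsto_const[of 1]] b_lim[OF that] by (auto simp: algebra_simps)
    \<comment> \<open>The mass identity rests on the inequalities between the parameters, which hold
      only for large \<open>\<tau>\<close>.\<close>
    show "\<forall>\<^sub>F \<tau> in at_top. laguerre_mass r (a \<tau>) (b \<tau>) / (b \<tau> h + 1) = laguerre_mass r (a \<tau>) ((b \<tau>)(h := b \<tau> h + 1))"
      using a_gt b_gt
    proof eventually_elim
      case (elim \<tau>)
      then show ?case using h by (intro laguerre_mass_shift[symmetric]) auto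
    qed
    have "(\<Prod>i\<in>{1..r}. gamma_egf (\<rho> i) ((d(h := d h + 1)) i))
      = gamma_egf (\<rho> h) (d h + 1) * (\<Prod>i\<in>{1..r} - {h}. gamma_egf (\<rho> i) (d i))"
      using h by (subst prod.remove[of _ h]) auto
    also have "\<dots> = gamma_egf (\<rho> h) 1 * (gamma_egf (\<rho> h) (d h) * (\<Prod>i\<in>{1..r} - {h}. gamma_egf (\<rho> i) (d i)))"
      using rho_pos[OF h] by (simp add: gamma_egf_add_one[symmetric] mult_ac)
    also have "gamma_egf (\<rho> h) (d h) * (\<Prod>i\<in>{1..r} - {h}. gamma_egf (\<rho> i) (d i)) = (\<Prod>i\<in>{1..r}. gamma_egf (\<rho> i) (d i))"
      using h by (subst prod.remove[of "{1..r}" h]) auto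
    finally show "has_egf (density_measure (K_op (\<rho> h) 1 F))
       ((\<Prod>i\<in>{1..r}. gamma_egf (\<rho> i) ((d(h := d h + 1)) i)) * gauss_egf ahat)"
      using has_egf_K_op[OF F rho_pos[OF h], of 1] by (simp add: mult.assoc)
  qed
  show ?thesis
    unfolding Let_def F_def[symmetric] using main shifted by blast
qed

end
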